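(* Let $q>0$, $0<\theta_{hl}<\theta_+$, and let $F$ be a smooth real function defined on an open interval $W$ containing $[\theta_{hl},\theta_+]$ such that $F(u)>0$ for $u\in[\theta_{hl},\theta_+)$, $F'(\theta_+)<0$, and $\theta_+$ is the unique zero of $F$ on $W$. For $R\geqslant0$ and $c>0$ consider the problem $$(\ast)\qquad \begin{cases}\theta_{xx}-c\theta_x+F(\theta)=0,\quad x\in(R,+\infty),\\ \theta(R)=\theta_{hl},\quad \theta_x(R)=c\theta_{hl}-qR,\\ \theta(x)\to\theta_+,\quad x\to+\infty,\end{cases}$$ for functions $\theta$ with values in $W$. Then: (i) There exists a smooth mapping $\psi(R)$ sending diffeomorphically the interval $[0,+\infty)$ onto the interval $[\psi(0),+\infty)$, where $\psi(0)>0$, such that for each $R\geqslant0$ and $c>0$, problem $(\ast)$ has a solution $\theta_{R,c}(x)$ if and only if $c=\psi(R)$; moreover, this solution is unique. (ii) The curve $\psi(R)$ is increasing from $\psi(0)$ to $+\infty$ and has the line $(\Delta): R\mapsto\frac{qR}{\theta_{hl}}$ as an asymptote, i.e. $\psi(R)-\frac{qR}{\theta_{hl}}\to0$ as $R\to+\infty$. (iii) The curve $\psi(R)$ is contained, for $R>0$, in $Q_+=\{(R,c): R>0,\ c\geqslant\frac{qR}{\theta_{hl}}\}$; more precisely, for all $R\geqslant0$, $$\frac{qR}{\theta_{hl}}<\psi(R)<c_+(R),\qquad c_+(R)=\frac{1}{\theta_{hl}}\left(\Big(2\int_{\theta_{hl}}^{\theta_+}F(u)\,du\Big)^{1/2}+qR\right).$$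 *)

theory Defs
  imports "HOL-Analysis.Analysis"
begin

text \<open>
  Infinitely differentiable on \<open>S\<close>, where \<open>S\<close> is a nondegenerate interval. Derivatives are taken
  relative to \<open>S\<close>: on an open interval this is the usual notion, and at an endpoint belonging
  to \<open>S\<close> they are one-sided. \<open>D k\<close> is the \<open>k\<close>-th derivative.
\<close>
definition smooth_on :: "real set \<Rightarrow> (real \<Rightarrow> real) \<Rightarrow> bool" where
  "smooth_on S f \<longleftrightarrow>
    (\<exists>D :: nat \<Rightarrow> real \<Rightarrow> real.
      (\<forall>x\<in>S. D 0 x = f x) \<and>
      (\<forall>k. \<forall>x\<in>S. (D k has_real_derivative D (Suc k) x) (at x within S)))"

definition diffeomorphism_betw :: "(real \<Rightarrow> real) \<Rightarrow> real set \<Rightarrow> real set \<Rightarrow> bool" where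
  "diffeomorphism_betw f S T \<longleftrightarrow>
    bij_betw f S T \<and> smooth_on S f \<and> smooth_on T (inv_into S f)"

text \<open>
  Classical solutions: \<open>\<theta>\<close> is \<open>C\<^sup>1\<close> on \<open>[R, \<infinity>)\<close>, so that \<open>\<theta>\<^sub>x(R)\<close> is the right derivative at
  \<open>R\<close>, and twice differentiable on \<open>(R, \<infinity>)\<close>. Here \<open>\<theta>1\<close> and \<open>\<theta>2\<close> are \<open>\<theta>\<^sub>x\<close> and \<open>\<theta>\<^sub>x\<^sub>x\<close>.
  Values of \<open>\<theta>\<close> to the left of \<open>R\<close> are irrelevant.
\<close>
definition is_solution ::
  "(real \<Rightarrow> real) \<Rightarrow> real set \<Rightarrow> real \<Rightarrow> real \<Rightarrow> real \<Rightarrow> real \<Rightarrow> real \<Rightarrow> (real \<Rightarrow> real) \<Rightarrow> bool" where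
  "is_solution F W q \<theta>hl \<theta>p R c \<theta> \<longleftrightarrow>
    (\<forall>x\<ge>R. \<theta> x \<in> W) \<and>
    (\<exists>\<theta>1 \<theta>2 :: real \<Rightarrow> real.
      (\<forall>x\<ge>R. (\<theta> has_real_derivative \<theta>1 x) (at x within {R..})) \<and>
      continuous_on {R..} \<theta>1 \<and>
      (\<forall>x>R. (\<theta>1 has_real_derivative \<theta>2 x) (at x)) \<and>
      (\<forall>x>R. \<theta>2 x - c * \<theta>1 x + F (\<theta> x) = 0) \<and>
      \<theta> R = \<theta>hl \<and>
      \<theta>1 R = c * \<theta>hl - q * R) \<and>
    (\<theta> \<longlongrightarrow> \<theta>p) at_top"

definition Q_plus :: "real \<Rightarrow> real \<Rightarrow> (real \<times> real) set" where
  "Q_plus q \<theta>hl = {(R, c). R > 0 \<and> c \<ge> q * R / \<theta>hl}"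

definition c_plus :: "(real \<Rightarrow> real) \<Rightarrow> real \<Rightarrow> real \<Rightarrow> real \<Rightarrow> real \<Rightarrow> real" where
  "c_plus F q \<theta>hl \<theta>p R = (1 / \<theta>hl) * (sqrt (2 * integral {\<theta>hl..\<theta>p} F) + q * R)"

end

theory Submission
  imports Defs "HOL-Complex_Analysis.Complex_Analysis"
begin

text \<open>
  Write \<open>a\<close> and \<open>b\<close> for the values of \<open>\<theta>\<close> at the left end and at infinity, and \<open>y = b - \<theta>\<close>. Since
  \<open>F' b < 0\<close>, the state \<open>(\<theta>, \<theta>\<^sub>x) = (b, 0)\<close> is a saddle for every speed \<open>c\<close>, and a solution
  that tends to \<open>b\<close> has to run on its stable curve. That curve is a graph \<open>\<theta>\<^sub>x = y * r y\<close> with \<open>r > 0\<close>.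
  Let \<open>P c\<close> be its height over \<open>\<theta> = a\<close>. The conditions at \<open>x = R\<close> then say exactly
  \<open>P c = c * a - q * R\<close>, that is \<open>G c = R\<close> for \<open>G c = (a * c - P c) / q\<close>, and \<open>\<psi>\<close> is the inverse of
  \<open>G\<close>. All assertions are properties of \<open>P\<close>: it is positive (lower bound), decreasing (so that
  \<open>G' \<ge> a / q\<close> and \<open>G\<close> is a bijection of the line), for \<open>c > 0\<close> smaller than the value given by the
  conserved energy of the equation without friction (upper bound), it tends to \<open>0\<close> as \<open>c\<close> grows (asymptote), and
  it is smooth.

  Smoothness and existence of the stable curve are obtained together. With \<open>F = y * f y\<close>, where \<open>f\<close> is
  continuous and positive also at \<open>y = 0\<close>, the curve satisfies \<open>(y * r y)' = f y / r y - c\<close>. The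
  nonlinearity is analytic in \<open>r\<close> and \<open>c\<close>, even though \<open>F\<close> is only smooth. Multiplying by \<open>y ^ (K - 1)\<close>
  and integrating gives, for every \<open>K \<ge> 1\<close>, the equation
  \<open>r y = \<integral>\<^bsub>[0,1]\<^esub> t ^ (K - 1) * ((K - 1) * r (t * y) + f (t * y) / r (t * y) - c) dt\<close>,
  whose right-hand side is a contraction on a suitable set of complex-valued functions when \<open>K\<close> is
  large, uniformly for \<open>c\<close> in a thin complex rectangle about a real interval (\<open>fixed_point\<close>).
  The iterates are holomorphic in \<open>c\<close>, hence so is the limit, and \<open>P\<close> is real analytic. The derivatives of the inverse of a real analytic map are then
  computed by a recursion inside the class of real analytic functions (\<open>real_analytic_inverse_smooth_on\<close>).

  That a solution follows the stable curve is seen from \<open>z = \<theta>\<^sub>x - y * r y\<close>, which satisfies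
  \<open>z' = (f y / r y) * z\<close> with positive coefficient: \<open>\<bar>z\<bar>\<close> cannot decrease, while convergence of \<open>\<theta>\<close>
  forces it to come close to \<open>0\<close> (\<open>solution_on_stable_curve\<close>). With \<open>r\<close> defined for both signs
  of \<open>y\<close> this covers orbits on either side of \<open>b\<close>, monotone or not.
\<close>

section \<open>Real analytic functions\<close>

text \<open>
  Local holomorphic extensions rather than power series: closure under derivatives and quotients is
  then inherited from holomorphic functions.
\<close>

definition real_analytic :: "(real \<Rightarrow> real) \<Rightarrow> bool" where
  "real_analytic g \<longleftrightarrow>
    (\<forall>x0. \<exists>U G. open U \<and> complex_of_real x0 \<in> U \<and> G holomorphic_on U \<and>
       (\<forall>x. complex_of_real x \<in> U \<longrightarrow> G (complex_of_real x) = complex_of_real (g x)))"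

lemma holomorphic_extension_deriv:
  assumes U: "open U" "complex_of_real x \<in> U" and G: "G holomorphic_on U"
    and eq: "\<And>x. complex_of_real x \<in> U \<Longrightarrow> G (complex_of_real x) = complex_of_real (g x)"
  shows "(g has_real_derivative deriv g x) (at x)"
    and "deriv G (complex_of_real x) = complex_of_real (deriv g x)"
proof -
  define z where "z = deriv G (complex_of_real x)"
  define S where "S = {t. complex_of_real t \<in> U}"
  have S: "open S" "x \<in> S"
    using U continuous_open_preimage[of UNIV complex_of_real U]
    by (auto simp: S_def vimage_def intro: continuous_intros)
  have "(G has_field_derivative z) (at (complex_of_real x))"
    using holomorphic_derivI[OF G U] by (simp add: z_def)
  then have v: "((\<lambda>t. G (complex_of_real t)) has_vector_derivative z) (at x)"
    by (rule has_vector_derivative_real_field)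
  have re: "((\<lambda>t. Re (G (complex_of_real t))) has_real_derivative Re z) (at x)"
    using bounded_linear.has_vector_derivative[OF bounded_linear_Re v]
    by (simp add: has_real_derivative_iff_has_vector_derivative)
  have im: "((\<lambda>t. Im (G (complex_of_real t))) has_real_derivative Im z) (at x)"
    using bounded_linear.has_vector_derivative[OF bounded_linear_Im v]
    by (simp add: has_real_derivative_iff_has_vector_derivative)
  have "(g has_real_derivative Re z) (at x)"
    by (rule has_field_derivative_transform_within_open[OF re S]) (auto simp: S_def eq)
  moreover have "((\<lambda>t. 0::real) has_real_derivative Im z) (at x)"
    by (rule has_field_derivative_transform_within_open[OF im S]) (auto simp: S_def eq)
  then have "Im z = 0"
    using DERIV_unique DERIV_const by blast
  ultimately show "(g has_real_derivative deriv g x) (at x)"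
    "deriv G (complex_of_real x) = complex_of_real (deriv g x)"
    by (auto simp: z_def complex_eq_iff DERIV_imp_deriv)
qed

lemma real_analytic_has_derivative:
  assumes "real_analytic g"
  shows "(g has_real_derivative deriv g x) (at x)"
  using assms holomorphic_extension_deriv(1) unfolding real_analytic_def by metis

lemma real_analytic_deriv:
  assumes "real_analytic g"
  shows "real_analytic (deriv g)"
  unfolding real_analytic_def
proof
  fix x0
  obtain U G where "open U" "complex_of_real x0 \<in> U" "G holomorphic_on U"
    "\<And>x. complex_of_real x \<in> U \<Longrightarrow> G (complex_of_real x) = complex_of_real (g x)"
    using assms unfolding real_analytic_def by metis
  then show "\<exists>U G. open U \<and> complex_of_real x0 \<in> U \<and> G holomorphic_on U \<and>
       (\<forall>x. complex_of_real x \<in> U \<longrightarrow> G (complex_of_real x) = complex_of_real (deriv g x))"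
    by (intro exI[of _ U] exI[of _ "deriv G"]) (auto simp: holomorphic_deriv holomorphic_extension_deriv(2))
qed

lemma real_analytic_ident: "real_analytic (\<lambda>x. x)"
  unfolding real_analytic_def
  by (intro allI exI[of _ UNIV] exI[of _ "\<lambda>z. z"]) (auto intro: holomorphic_intros)

lemma real_analytic_divide:
  assumes "real_analytic g" "real_analytic h" and nz: "\<And>x. h x \<noteq> 0"
  shows "real_analytic (\<lambda>x. g x / h x)"
  unfolding real_analytic_def
proof
  fix x0
  obtain U G where U: "open U" "complex_of_real x0 \<in> U" "G holomorphic_on U"
    "\<And>x. complex_of_real x \<in> U \<Longrightarrow> G (complex_of_real x) = complex_of_real (g x)"
    using assms(1) unfolding real_analytic_def by metis
  obtain V H where V: "open V" "complex_of_real x0 \<in> V" "H holomorphic_on V"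
    "\<And>x. complex_of_real x \<in> V \<Longrightarrow> H (complex_of_real x) = complex_of_real (h x)"
    using assms(2) unfolding real_analytic_def by metis
  define X where "X = U \<inter> (V \<inter> H -` (- {0}))"
  have "open X"
    unfolding X_def using U(1) V(1,3)
    by (intro open_Int continuous_open_preimage holomorphic_on_imp_continuous_on) auto
  moreover have "(\<lambda>z. G z / H z) holomorphic_on X"
    by (intro holomorphic_on_divide holomorphic_on_subset[OF U(3)] holomorphic_on_subset[OF V(3)])
      (auto simp: X_def)
  ultimately show "\<exists>U G. open U \<and> complex_of_real x0 \<in> U \<and> G holomorphic_on U \<and>
       (\<forall>x. complex_of_real x \<in> U \<longrightarrow> G (complex_of_real x) = complex_of_real (g x / h x))"
    using U V nz by (intro exI[of _ X] exI[of _ "\<lambda>z. G z / H z"]) (auto simp: X_def)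
qed

lemma real_analytic_imp_smooth_on:
  assumes "real_analytic g"
  shows "smooth_on S g"
proof -
  have "real_analytic ((deriv ^^ k) g)" for k
    by (induction k) (auto simp: assms real_analytic_deriv)
  then show ?thesis
    unfolding smooth_on_def
    by (intro exI[of _ "\<lambda>k. (deriv ^^ k) g"])
      (auto intro: has_field_derivative_at_within real_analytic_has_derivative)
qed

text \<open>
  If \<open>H' = 1 / G' \<circ> H\<close>, every derivative of \<open>H\<close> has the form \<open>N\<^sub>k \<circ> H\<close> with \<open>N\<^sub>0\<close> the identity and
  \<open>N\<^bsub>k+1\<^esub> = N\<^sub>k' / G'\<close>. All \<open>N\<^sub>k\<close> are real analytic because \<open>G\<close> is.
\<close>

lemma real_analytic_inverse_smooth_on:
  assumes G: "real_analytic G" and nz: "\<And>x. deriv G x \<noteq> 0"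
    and H: "\<And>y. (H has_real_derivative 1 / deriv G (H y)) (at y)"
  shows "smooth_on S H"
proof -
  define N where "N = rec_nat (\<lambda>x. x) (\<lambda>_ u x. deriv u x / deriv G x)"
  have N: "real_analytic (N k)" for k
    by (induction k)
      (auto simp: N_def real_analytic_ident intro!: real_analytic_divide real_analytic_deriv G nz)
  have "((\<lambda>y. N k (H y)) has_real_derivative N (Suc k) (H y)) (at y within S)" for k y
    using DERIV_chain2[OF real_analytic_has_derivative[OF N] H, of k y]
    by (auto simp: N_def intro: has_field_derivative_at_within)
  then show ?thesis
    unfolding smooth_on_def
    by (intro exI[of _ "\<lambda>k y. N k (H y)"]) (auto simp: N_def)
qed

section \<open>Inverses of expanding maps of the line\<close>

lemma inverse_of_expanding_map:
  fixes X X' :: "real \<Rightarrow> real"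
  assumes der: "\<And>x. (X has_real_derivative X' x) (at x)"
    and mu: "\<mu> > 0" "\<And>x. X' x \<ge> \<mu>"
  shows "strict_mono X" and "bij X"
    and "\<And>y. (inv X has_real_derivative 1 / X' (inv X y)) (at y)"
proof -
  have grow: "X x + \<mu> * (y - x) \<le> X y" if "x \<le> y" for x y
  proof -
    have "X x - \<mu> * x \<le> X y - \<mu> * y"
    proof (rule DERIV_nonneg_imp_nondecreasing[OF that])
      fix t
      have "((\<lambda>t. X t - \<mu> * t) has_real_derivative X' t - \<mu>) (at t)"
        by (auto intro!: derivative_eq_intros der)
      then show "\<exists>y. ((\<lambda>t. X t - \<mu> * t) has_real_derivative y) (at t) \<and> 0 \<le> y"
        using mu(2)[of t] by force
    qed
    then show ?thesis by (simp add: algebra_simps)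
  qed
  show mono: "strict_mono X"
  proof (rule strict_monoI)
    fix x y :: real assume "x < y"
    then show "X x < X y" using grow[of x y] mult_pos_pos[OF mu(1), of "y - x"] by linarith
  qed
  have cont: "continuous_on S X" for S
    using der DERIV_isCont continuous_at_imp_continuous_on by blast
  have "surj X"
  proof -
    have "\<exists>x. X x = y" for y
    proof -
      define s where "s = \<bar>y - X 0\<bar> / \<mu>"
      have s: "s \<ge> 0" "\<mu> * s = \<bar>y - X 0\<bar>" using mu(1) by (auto simp: s_def)
      have "X (- s) \<le> y" "y \<le> X s" using grow[of 0 s] grow[of "-s" 0] s by auto
      then show ?thesis using IVT'[of X "-s" y s] s cont by auto
    qed
    then show ?thesis by (metis surjI)
  qed
  then show bij: "bij X" using mono strict_mono_imp_inj_on by (auto simp: bij_def)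
  have X_inv: "X (inv X y) = y" for y using \<open>surj X\<close> by (rule surj_f_inv_f)
  have lip: "\<bar>inv X y - inv X z\<bar> \<le> \<bar>y - z\<bar> / \<mu>" for y z
  proof -
    have "\<mu> * \<bar>inv X y - inv X z\<bar> \<le> \<bar>y - z\<bar>"
      using grow[of "inv X y" "inv X z"] grow[of "inv X z" "inv X y"] X_inv[of y] X_inv[of z]
      by (cases "inv X y \<le> inv X z") (auto simp: abs_if)
    then show ?thesis using mu(1) by (simp add: field_simps)
  qed
  have "(1/\<mu>)-lipschitz_on UNIV (inv X)"
    using lip mu(1) by (auto simp: lipschitz_on_def dist_real_def)
  then have "continuous_on UNIV (inv X)" by (rule lipschitz_on_continuous_on)
  then have "isCont (inv X) y" for y by (simp add: continuous_on_eq_continuous_at)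
  then show "(inv X has_real_derivative 1 / X' (inv X y)) (at y)" for y
    using DERIV_inverse_function[of X "X' (inv X y)" "inv X" y "y - 1" "y + 1"] der X_inv mu
    by (metis inverse_eq_divide less_add_one lt_ex not_less order_less_le_trans diff_less_eq)
qed

section \<open>The integral equation for the stable curve\<close>

text \<open>
  The kernel of the integral equation averages \<open>r + (f / r - r - c) / K\<close>, an explicit Euler step of length
  \<open>1 / K\<close> for \<open>r' = f / r - r - c\<close>. The rectangle \<open>[lo, hi] \<times> [-e, e]\<close> is invariant under that flow when
  \<open>lo\<close> is small and \<open>hi\<close> is large, measured by the bounds of \<open>f\<close> and \<open>c\<close>; the hypotheses on \<open>K\<close> make the
  Euler step respect the rectangle and contract on it. \<open>e \<le> lo\<close> keeps the rectangle in the sector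
  \<open>\<bar>arg r\<bar> \<le> \<pi> / 4\<close>, where products of two elements have nonnegative real part.
\<close>

locale slope_box =
  fixes f :: "real \<Rightarrow> real" and l h m M lo hi e C :: real and K :: nat
  assumes lh: "l \<le> 0" "0 \<le> h"
    and f_cont: "continuous_on {l..h} f"
    and f_bounds: "\<And>y. y \<in> {l..h} \<Longrightarrow> m \<le> f y \<and> f y \<le> M"
    and m_pos: "0 < m" and C_pos: "0 < C" and lo_pos: "0 < lo" and e_pos: "0 < e"
    and lo_le_hi: "lo \<le> hi" and e_le: "e \<le> lo"
    and lo_small: "4 * lo * (lo + C) \<le> m"
    and hi_large: "2 * M / hi + C \<le> hi"
    and K_lo: "C \<le> (real K - 2) * lo"
    and K_hi: "M / lo + C \<le> real K * (hi / 2)"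
    and K_M: "1 + M / lo\<^sup>2 \<le> real K"
    and K_M2: "1 + (M / lo\<^sup>2)\<^sup>2 \<le> real K"
begin

abbreviation "J \<equiv> {l..h}"
definition "rect = {z. lo \<le> Re z \<and> Re z \<le> hi \<and> \<bar>Im z\<bar> \<le> e}"
definition "V = {c. \<bar>Re c\<bar> < C \<and> \<bar>Im c\<bar> < e}"
definition "\<Phi> y r c = (of_nat K - 1) * r + of_real (f y) / r - (c::complex)"
definition "T u y c = integral {0..1} (\<lambda>t. of_real (t ^ (K - 1)) * \<Phi> (t * y) (u (t * y) c) c)"

lemma K_ge2: "K \<ge> 2"
proof (rule ccontr)
  assume "\<not> K \<ge> 2"
  then have "(real K - 2) * lo \<le> 0" using lo_pos by (intro mult_nonpos_nonneg) auto
  then show False using K_lo C_pos by linarith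
qed

lemma M_pos: "0 < M"
  using f_bounds[of 0] lh m_pos by auto

lemma scale_J: "t * y \<in> J" if "y \<in> J" "t \<in> {0..1}"
proof -
  have "l \<le> t * l" "t * h \<le> h" using that lh by (auto simp: mult_left_le_one_le mult_le_cancel_right1)
  moreover have "t * l \<le> t * y" "t * y \<le> t * h" using that by (auto intro: mult_left_mono)
  ultimately show ?thesis by auto
qed

lemma rect_norm:
  assumes "r \<in> rect"
  shows "r \<noteq> 0" "lo\<^sup>2 \<le> (Re r)\<^sup>2 + (Im r)\<^sup>2" "(Re r)\<^sup>2 + (Im r)\<^sup>2 \<le> 2 * (Re r)\<^sup>2"
proof -
  have *: "lo \<le> Re r" "\<bar>Im r\<bar> \<le> Re r" using assms e_le by (auto simp: rect_def)
  show "r \<noteq> 0" using * lo_pos by auto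
  have "lo\<^sup>2 \<le> (Re r)\<^sup>2" using * lo_pos by (intro power_mono) auto
  then show "lo\<^sup>2 \<le> (Re r)\<^sup>2 + (Im r)\<^sup>2" by (simp add: add_increasing2)
  have "(Im r)\<^sup>2 \<le> (Re r)\<^sup>2" using * lo_pos by (intro abs_le_square_iff[THEN iffD1]) auto
  then show "(Re r)\<^sup>2 + (Im r)\<^sup>2 \<le> 2 * (Re r)\<^sup>2" by simp
qed

text \<open>
  The two barriers in the real direction are checked by cases. Near the barrier \<open>f / r\<close>
  dominates (\<open>lo\<close>) or is dominated (\<open>hi\<close>); away from it, at distance at least \<open>lo\<close> or \<open>hi / 2\<close>, a
  step of length \<open>1 / K\<close> is too short to cross it.
  In the imaginary direction \<open>f / r\<close> pulls towards the real axis.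
\<close>

lemma \<Phi>_box:
  assumes y: "y \<in> J" and r: "r \<in> rect" and c: "c \<in> V"
  shows "real K * lo \<le> Re (\<Phi> y r c)" "Re (\<Phi> y r c) \<le> real K * hi" "\<bar>Im (\<Phi> y r c)\<bar> \<le> real K * e"
proof -
  define x v n where "x = Re r" and "v = Im r" and "n = x\<^sup>2 + v\<^sup>2"
  have f: "m \<le> f y" "f y \<le> M" "0 < f y" using f_bounds[OF y] m_pos by auto
  have x: "lo \<le> x" "x \<le> hi" "\<bar>v\<bar> \<le> e" "0 < x" using r lo_pos by (auto simp: rect_def x_def v_def)
  have n: "lo\<^sup>2 \<le> n" "n \<le> 2 * x\<^sup>2" "x\<^sup>2 \<le> n" "0 < n"
    using rect_norm[OF r] x by (auto simp: x_def v_def n_def add_pos_nonneg)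
  have c': "\<bar>Re c\<bar> < C" "\<bar>Im c\<bar> < e" using c by (auto simp: V_def)
  have Re: "Re (\<Phi> y r c) = (real K - 1) * x + f y * x / n - Re c"
    by (simp add: \<Phi>_def x_def v_def n_def Re_divide)
  have Im: "Im (\<Phi> y r c) = (real K - 1 - f y / n) * v - Im c"
    by (simp add: \<Phi>_def x_def v_def n_def Im_divide algebra_simps)
  have frac_lo: "m / (2 * x) \<le> f y * x / n"
  proof -
    have "m * n \<le> f y * (2 * x\<^sup>2)" using f n m_pos by (intro mult_mono) auto
    then show ?thesis using x n by (simp add: field_simps power2_eq_square)
  qed
  have frac_hi: "f y * x / n \<le> M / x"
  proof -
    have "f y * x\<^sup>2 \<le> M * n" using f n by (intro mult_mono) auto
    then show ?thesis using x n by (simp add: field_simps power2_eq_square)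
  qed
  have K1: "real K - 1 \<ge> 0" "real K - 2 \<ge> 0" using K_ge2 by auto
  show "real K * lo \<le> Re (\<Phi> y r c)"
  proof (cases "x \<le> 2 * lo")
    case True
    have "(real K - 1) * lo \<le> (real K - 1) * x" using K1 x by (intro mult_left_mono) auto
    moreover have "lo + C \<le> m / (2 * x)"
    proof -
      have "(lo + C) * (2 * x) \<le> (lo + C) * (4 * lo)" using True C_pos lo_pos by (intro mult_left_mono) auto
      then show ?thesis using lo_small x by (simp add: field_simps)
    qed
    ultimately show ?thesis unfolding Re using frac_lo c' by (simp add: algebra_simps abs_if split: if_splits)
  next
    case False
    have "(real K - 1) * (2 * lo) \<le> (real K - 1) * x" using K1 False by (intro mult_left_mono) auto
    moreover have "0 \<le> f y * x / n" using f x n by auto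
    ultimately show ?thesis unfolding Re using K_lo c' by (simp add: algebra_simps abs_if split: if_splits)
  qed
  show "Re (\<Phi> y r c) \<le> real K * hi"
  proof (cases "x \<le> hi / 2")
    case True
    have "(real K - 1) * x \<le> (real K - 1) * (hi / 2)" using K1 True by (intro mult_left_mono) auto
    moreover have "M / x \<le> M / lo" using x M_pos lo_pos by (intro divide_left_mono) auto
    moreover have "0 \<le> hi" using x by linarith
    moreover have "(real K - 1) * (hi / 2) = real K * (hi / 2) - hi / 2"
      "real K * hi = real K * (hi / 2) + real K * (hi / 2)"
      by (simp_all add: field_simps)
    ultimately show ?thesis unfolding Re using K_hi frac_hi c' by linarith
  next
    case False
    have "(real K - 1) * x \<le> (real K - 1) * hi" using K1 x by (intro mult_left_mono) auto
    moreover have "M / x \<le> M / (hi / 2)" using x M_pos False by (intro divide_left_mono) auto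
    ultimately show ?thesis unfolding Re using hi_large frac_hi c'
      by (simp add: algebra_simps abs_if split: if_splits)
  qed
  have "f y / n \<le> M / lo\<^sup>2" using f n lo_pos by (intro frac_le) auto
  then have b: "0 \<le> real K - 1 - f y / n" "real K - 1 - f y / n \<le> real K - 1"
    using K_M f n by auto
  have "\<bar>(real K - 1 - f y / n) * v\<bar> \<le> (real K - 1) * e"
    unfolding abs_mult using b x by (intro mult_mono) auto
  then show "\<bar>Im (\<Phi> y r c)\<bar> \<le> real K * e"
    unfolding Im left_diff_distrib[of "real K" 1 e] using c'(2)
      abs_triangle_ineq4[of "(real K - 1 - f y / n) * v" "Im c"] by linarith
qed

text \<open>
  The difference quotient is \<open>K - 1 - z\<close> with \<open>z = f y / (r * s)\<close> bounded and \<open>Re z \<ge> 0\<close>. Hence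
  its squared norm is at most \<open>(K - 1)\<^sup>2 + \<bar>z\<bar>\<^sup>2\<close>, which does not exceed \<open>(K - 1/2)\<^sup>2\<close> for large \<open>K\<close>.
\<close>

lemma \<Phi>_contraction:
  assumes y: "y \<in> J" and r: "r \<in> rect" and s: "s \<in> rect"
  shows "norm (\<Phi> y r c - \<Phi> y s c) \<le> (real K - 1/2) * norm (r - s)"
proof -
  have f: "f y \<le> M" "0 < f y" using f_bounds[OF y] m_pos by auto
  have nz: "r \<noteq> 0" "s \<noteq> 0" using rect_norm r s by auto
  define z where "z = of_real (f y) / (r * s)"
  have eq: "\<Phi> y r c - \<Phi> y s c = (of_nat K - 1 - z) * (r - s)"
    using nz by (simp add: \<Phi>_def z_def field_simps)
  have norms: "lo \<le> norm r" "lo \<le> norm s"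
    using rect_norm[OF r] rect_norm[OF s] by (auto simp: cmod_def intro: real_le_rsqrt)
  have "norm z \<le> M / lo\<^sup>2"
    unfolding z_def norm_divide norm_mult power2_eq_square
    using f norms lo_pos by (intro frac_le mult_mono) auto
  then have z2: "(Re z)\<^sup>2 + (Im z)\<^sup>2 \<le> (M / lo\<^sup>2)\<^sup>2"
    by (metis cmod_power2 norm_ge_zero power_mono)
  have "\<bar>Im r * Im s\<bar> \<le> Re r * Re s"
    unfolding abs_mult using r s e_le by (intro mult_mono) (auto simp: rect_def)
  then have "0 \<le> Re (r * s)" by simp
  then have Rez: "0 \<le> Re z"
    using f unfolding z_def by (simp add: Re_divide del: times_complex.simps)
  have "(norm (of_nat K - 1 - z))\<^sup>2 = (real K - 1)\<^sup>2 - 2 * (real K - 1) * Re z + ((Re z)\<^sup>2 + (Im z)\<^sup>2)"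
    unfolding cmod_power2 by (simp add: power2_eq_square algebra_simps)
  also have "\<dots> \<le> (real K - 1)\<^sup>2 + (M / lo\<^sup>2)\<^sup>2"
  proof -
    have "0 \<le> 2 * (real K - 1) * Re z" using Rez K_ge2 by (intro mult_nonneg_nonneg) auto
    then show ?thesis using z2 by linarith
  qed
  also have "\<dots> \<le> (real K - 1/2)\<^sup>2"
    using K_M2 by (simp add: power2_eq_square algebra_simps)
  finally have "norm (of_nat K - 1 - z) \<le> real K - 1/2"
    by (rule power2_le_imp_le) (use K_ge2 in auto)
  then show ?thesis
    unfolding eq norm_mult by (intro mult_right_mono) auto
qed

lemma rect_closed: "closed rect" and V_open: "open V" and V_convex: "convex V"
proof -
  have "rect = {z. lo \<le> Re z} \<inter> {z. Re z \<le> hi} \<inter> {z. \<bar>Im z\<bar> \<le> e}" by (auto simp: rect_def)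
  then show "closed rect"
    by (auto intro!: closed_Int closed_Collect_le continuous_intros)
  have "V = {z. \<bar>Re z\<bar> < C} \<inter> {z. \<bar>Im z\<bar> < e}" by (auto simp: V_def)
  then show "open V"
    by (auto intro!: open_Int open_Collect_less continuous_intros)
  have "V = {z. Re z < C} \<inter> {z. Re z > -C} \<inter> {z. Im z < e} \<inter> {z. Im z > -e}" by (auto simp: V_def)
  then show "convex V"
    by (auto intro!: convex_Int convex_halfspace_Re_lt convex_halfspace_Re_gt convex_halfspace_Im_lt convex_halfspace_Im_gt)
qed

definition "admissible u \<longleftrightarrow>
  continuous_on (J \<times> V) (\<lambda>(y, c). u y c) \<and> (\<forall>y\<in>J. \<forall>c\<in>V. u y c \<in> rect)"

lemma admissibleD:
  assumes "admissible u"
  shows "continuous_on (J \<times> V) (\<lambda>(y, c). u y c)" "\<And>y c. y \<in> J \<Longrightarrow> c \<in> V \<Longrightarrow> u y c \<in> rect"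
  using assms by (auto simp: admissible_def)

lemma \<Phi>_cont:
  assumes "admissible u"
  shows "continuous_on ((J \<times> V) \<times> {0..1})
     (\<lambda>((y, c), t). of_real (t ^ (K - 1)) * \<Phi> (t * y) (u (t * y) c) c)"
proof -
  have u: "continuous_on ((J \<times> V) \<times> {0..1}) (\<lambda>p. u (snd p * fst (fst p)) (snd (fst p)))"
  proof -
    have "continuous_on ((J \<times> V) \<times> {0..1})
      (\<lambda>p. (\<lambda>(y, c). u y c) (snd p * fst (fst p), snd (fst p)))"
      by (rule continuous_on_compose2[OF admissibleD(1)[OF assms]])
        (use scale_J in \<open>auto intro!: continuous_intros simp del: atLeastAtMost_iff\<close>)
    then show ?thesis by simp
  qed
  have nz: "u (snd p * fst (fst p)) (snd (fst p)) \<noteq> 0" if "p \<in> (J \<times> V) \<times> {0..1}" for p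
    using that assms scale_J
    by (intro rect_norm(1) admissibleD(2)) (auto simp del: atLeastAtMost_iff)
  have f: "continuous_on ((J \<times> V) \<times> {0..1::real}) (\<lambda>p. f (snd p * fst (fst p)))"
    by (rule continuous_on_compose2[OF f_cont])
      (use scale_J in \<open>auto intro!: continuous_intros simp del: atLeastAtMost_iff\<close>)
  show ?thesis
    unfolding split_beta \<Phi>_def using nz
    by (intro continuous_intros u f) blast
qed

lemma integrand_cont:
  assumes "admissible u" "y \<in> J" "c \<in> V"
  shows "continuous_on {0..1} (\<lambda>t. of_real (t ^ (K - 1)) * \<Phi> (t * y) (u (t * y) c) c)"
proof -
  have "continuous_on {0..1} (\<lambda>t. (\<lambda>((y, c), t). of_real (t ^ (K - 1)) * \<Phi> (t * y) (u (t * y) c) c) ((y, c), t))"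
    by (rule continuous_on_compose2[OF \<Phi>_cont[OF assms(1)]])
      (use assms in \<open>auto intro!: continuous_intros\<close>)
  then show ?thesis by simp
qed

lemma weight_integral: "((\<lambda>t::real. t ^ (K - 1) * B) has_integral B / real K) {0..1}"
proof -
  have "((\<lambda>t::real. t ^ (K - 1) * B) has_integral (1 ^ K * (B / real K) - 0 ^ K * (B / real K))) {0..1}"
    using K_ge2
    by (intro fundamental_theorem_of_calculus)
      (auto intro!: derivative_eq_intros simp: has_real_derivative_iff_has_vector_derivative[symmetric])
  then show ?thesis using K_ge2 by (simp add: zero_power)
qed

lemma T_has_integral:
  assumes "admissible u" "y \<in> J" "c \<in> V"
  shows "((\<lambda>t. of_real (t ^ (K - 1)) * \<Phi> (t * y) (u (t * y) c) c) has_integral T u y c) {0..1}"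
  unfolding T_def using integrand_cont[OF assms]
  by (intro integrable_integral integrable_continuous_interval)

lemma T_box:
  assumes u: "admissible u" and y: "y \<in> J" and c: "c \<in> V"
  shows "T u y c \<in> rect"
proof -
  let ?g = "\<lambda>t. of_real (t ^ (K - 1)) * \<Phi> (t * y) (u (t * y) c) c"
  note I = T_has_integral[OF assms]
  have Re: "((\<lambda>t. t ^ (K - 1) * Re (\<Phi> (t * y) (u (t * y) c) c)) has_integral Re (T u y c)) {0..1}"
    using has_integral_linear[OF I bounded_linear_Re] by (simp add: o_def)
  have Im: "((\<lambda>t. t ^ (K - 1) * Im (\<Phi> (t * y) (u (t * y) c) c)) has_integral Im (T u y c)) {0..1}"
    using has_integral_linear[OF I bounded_linear_Im] by (simp add: o_def)
  have P: "real K * lo \<le> Re (\<Phi> (t * y) (u (t * y) c) c)" "Re (\<Phi> (t * y) (u (t * y) c) c) \<le> real K * hi"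
    "\<bar>Im (\<Phi> (t * y) (u (t * y) c) c)\<bar> \<le> real K * e" if "t \<in> {0..1}" for t
    using \<Phi>_box[OF scale_J[OF y that] admissibleD(2)[OF u scale_J[OF y that] c] c] by auto
  have K: "real K \<noteq> 0" using K_ge2 by simp
  have "(real K * lo) / real K \<le> Re (T u y c)"
    by (rule has_integral_le[OF weight_integral Re]) (use P in \<open>auto intro: mult_left_mono\<close>)
  moreover have "Re (T u y c) \<le> (real K * hi) / real K"
    by (rule has_integral_le[OF Re weight_integral]) (use P in \<open>auto intro: mult_left_mono\<close>)
  moreover have "(real K * - e) / real K \<le> Im (T u y c)"
    by (rule has_integral_le[OF weight_integral Im], rule mult_left_mono)
       (use P in \<open>fastforce simp: abs_le_iff\<close>)+
  moreover have "Im (T u y c) \<le> (real K * e) / real K"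
    by (rule has_integral_le[OF Im weight_integral], rule mult_left_mono)
       (use P in \<open>fastforce simp: abs_le_iff\<close>)+
  ultimately show ?thesis using K by (auto simp: rect_def abs_le_iff)
qed

lemma T_admissible:
  assumes u: "admissible u"
  shows "admissible (T u)"
proof -
  have "continuous_on (J \<times> V) (\<lambda>p. integral (cbox 0 1)
     ((\<lambda>p t. of_real (t ^ (K - 1)) * \<Phi> (t * fst p) (u (t * fst p) (snd p)) (snd p)) p))"
    using \<Phi>_cont[OF u] by (intro integral_continuous_on_param) (simp add: split_beta)
  then show ?thesis
    using T_box[OF u] by (auto simp: admissible_def T_def split_beta)
qed

lemma T_contraction:
  assumes u: "admissible u" and w: "admissible w" and y: "y \<in> J" and c: "c \<in> V"
    and B: "\<And>y. y \<in> J \<Longrightarrow> norm (u y c - w y c) \<le> B"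
  shows "norm (T u y c - T w y c) \<le> (real K - 1/2) / real K * B"
proof -
  have "((\<lambda>t. of_real (t ^ (K - 1)) * (\<Phi> (t * y) (u (t * y) c) c - \<Phi> (t * y) (w (t * y) c) c))
     has_integral (T u y c - T w y c)) {0..1}"
    using has_integral_diff[OF T_has_integral[OF u y c] T_has_integral[OF w y c]]
    by (simp add: algebra_simps)
  then have "norm (T u y c - T w y c) \<le> ((real K - 1/2) * B / real K) \<bullet> 1"
  proof (rule has_integral_norm_bound_integral_component[OF _ weight_integral])
    fix t :: real assume t: "t \<in> {0..1}"
    note ty = scale_J[OF y t]
    have "norm (\<Phi> (t * y) (u (t * y) c) c - \<Phi> (t * y) (w (t * y) c) c)
      \<le> (real K - 1/2) * norm (u (t * y) c - w (t * y) c)"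
      using ty c u w by (intro \<Phi>_contraction admissibleD(2))
    also have "\<dots> \<le> (real K - 1/2) * B"
      using B[OF ty] K_ge2 by (intro mult_left_mono) auto
    finally show "norm (of_real (t ^ (K - 1)) * (\<Phi> (t * y) (u (t * y) c) c - \<Phi> (t * y) (w (t * y) c) c))
      \<le> (t ^ (K - 1) * ((real K - 1/2) * B)) \<bullet> 1"
      using t unfolding norm_mult by (auto intro!: mult_mono simp: norm_power)
  qed
  then show ?thesis by simp
qed

text \<open>
  Joint continuity of the derivative is what differentiation under the integral sign needs, so it is
  carried along the iteration.
\<close>

definition "analytic_in_c u \<longleftrightarrow> (\<exists>u'. continuous_on (J \<times> V) (\<lambda>(y, c). u' y c) \<and>
  (\<forall>y\<in>J. \<forall>c\<in>V. (u y has_field_derivative u' y c) (at c within V)))"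

lemma T_analytic:
  assumes u: "admissible u" and a: "analytic_in_c u"
  shows "analytic_in_c (T u)"
proof -
  obtain u' where u'_cont: "continuous_on (J \<times> V) (\<lambda>(y, c). u' y c)"
    and u': "\<And>y c. y \<in> J \<Longrightarrow> c \<in> V \<Longrightarrow> (u y has_field_derivative u' y c) (at c within V)"
    using a unfolding analytic_in_c_def by blast
  define D where "D y c t = of_real (t ^ (K - 1)) *
    ((of_nat K - 1) * u' (t * y) c - of_real (f (t * y)) * u' (t * y) c / (u (t * y) c)\<^sup>2 - 1)" for y c t
  have nz: "u y c \<noteq> 0" if "y \<in> J" "c \<in> V" for y c
    using that u by (intro rect_norm(1) admissibleD(2))
  have D_cont: "continuous_on ((J \<times> V) \<times> {0..1}) (\<lambda>((y, c), t). D y c t)"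
  proof -
    have cont: "continuous_on ((J \<times> V) \<times> {0..1}) (\<lambda>p. w (snd p * fst (fst p)) (snd (fst p)))"
      if w: "continuous_on (J \<times> V) (\<lambda>(y, c). w y c)" for w :: "real \<Rightarrow> complex \<Rightarrow> complex"
    proof -
      have "continuous_on ((J \<times> V) \<times> {0..1})
        (\<lambda>p. (\<lambda>(y, c). w y c) (snd p * fst (fst p), snd (fst p)))"
        by (rule continuous_on_compose2[OF w])
          (use scale_J in \<open>auto intro!: continuous_intros simp del: atLeastAtMost_iff\<close>)
      then show ?thesis by simp
    qed
    have f: "continuous_on ((J \<times> V) \<times> {0..1::real}) (\<lambda>p. f (snd p * fst (fst p)))"
      by (rule continuous_on_compose2[OF f_cont])
        (use scale_J in \<open>auto intro!: continuous_intros simp del: atLeastAtMost_iff\<close>)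
    have "u (snd p * fst (fst p)) (snd (fst p)) \<noteq> 0" if "p \<in> (J \<times> V) \<times> {0..1}" for p
      using that scale_J by (intro nz) (auto simp del: atLeastAtMost_iff)
    then show ?thesis
      unfolding split_beta D_def
      by (intro continuous_intros f cont[OF u'_cont] cont[OF admissibleD(1)[OF u]]) simp
  qed
  have "continuous_on (J \<times> V) (\<lambda>p. integral (cbox 0 1) ((\<lambda>p t. D (fst p) (snd p) t) p))"
    using D_cont by (intro integral_continuous_on_param) (simp add: split_beta)
  then have 1: "continuous_on (J \<times> V) (\<lambda>(y, c). integral {0..1} (D y c))"
    by (simp add: split_beta)
  have 2: "(T u y has_field_derivative integral {0..1} (D y c)) (at c within V)"
    if y: "y \<in> J" and c: "c \<in> V" for y c
    unfolding T_def box_real[symmetric]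
  proof (rule leibniz_rule_field_derivative[OF _ _ _ c V_convex])
    fix x and t :: real assume x: "x \<in> V" and "t \<in> cbox 0 1"
    then have t: "t \<in> {0..1}" by simp
    show "((\<lambda>x. of_real (t ^ (K - 1)) * \<Phi> (t * y) (u (t * y) x) x) has_field_derivative D y x t) (at x within V)"
      unfolding \<Phi>_def D_def
      by (rule derivative_eq_intros refl u'[OF scale_J[OF y t] x] nz[OF scale_J[OF y t] x])+
        (use nz[OF scale_J[OF y t] x] in \<open>simp add: power2_eq_square field_simps\<close>)
  next
    fix x assume "x \<in> V"
    then show "(\<lambda>t. of_real (t ^ (K - 1)) * \<Phi> (t * y) (u (t * y) x) x) integrable_on cbox 0 1"
      using integrand_cont[OF u y] by (auto intro: integrable_continuous_interval)
  next
    have "continuous_on (V \<times> {0..1}) (\<lambda>p. (\<lambda>((y, c), t). D y c t) ((y, fst p), snd p))"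
      by (rule continuous_on_compose2[OF D_cont]) (use y in \<open>auto intro!: continuous_intros\<close>)
    then show "continuous_on (V \<times> cbox 0 1) (\<lambda>(x, t). D y x t)"
      by (simp add: split_beta)
  qed
  show ?thesis
    unfolding analytic_in_c_def using 1 2 by (intro exI[of _ "\<lambda>y c. integral {0..1} (D y c)"]) blast
qed

definition "real_on_reals u \<longleftrightarrow> (\<forall>y\<in>J. \<forall>c\<in>V. Im c = 0 \<longrightarrow> Im (u y c) = 0)"

lemma T_real:
  assumes u: "admissible u" and "real_on_reals u"
  shows "real_on_reals (T u)"
  unfolding real_on_reals_def
proof safe
  fix y c assume y: "y \<in> J" and c: "c \<in> V" "Im c = 0"
  have Im: "((\<lambda>t. t ^ (K - 1) * Im (\<Phi> (t * y) (u (t * y) c) c)) has_integral Im (T u y c)) {0..1}"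
    using has_integral_linear[OF T_has_integral[OF u y c(1)] bounded_linear_Im] by (simp add: o_def)
  have "t ^ (K - 1) * Im (\<Phi> (t * y) (u (t * y) c) c) = 0" if t: "t \<in> {0..1}" for t
  proof -
    have "Im (u (t * y) c) = 0"
      using assms(2) scale_J[OF y t] c unfolding real_on_reals_def by blast
    then show ?thesis using c by (simp add: \<Phi>_def Im_divide)
  qed
  then have "((\<lambda>t. t ^ (K - 1) * Im (\<Phi> (t * y) (u (t * y) c) c)) has_integral 0) {0..1}"
    by (intro has_integral_is_0) auto
  then show "Im (T u y c) = 0" using Im has_integral_unique by blast
qed

primrec iterate :: "nat \<Rightarrow> real \<Rightarrow> complex \<Rightarrow> complex" where
  "iterate 0 = (\<lambda>y c. of_real lo)"
| "iterate (Suc n) = T (iterate n)"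

lemma iterate_props:
  "admissible (iterate n) \<and> analytic_in_c (iterate n) \<and> real_on_reals (iterate n)"
proof (induction n)
  case 0
  have "admissible (iterate 0)"
    using lo_le_hi e_pos by (auto simp: admissible_def rect_def split_beta)
  moreover have "analytic_in_c (iterate 0)"
    unfolding analytic_in_c_def
    by (intro exI[of _ "\<lambda>y c. 0"]) (auto simp: split_beta intro!: derivative_eq_intros)
  ultimately show ?case by (auto simp: real_on_reals_def)
next
  case (Suc n)
  then show ?case using T_admissible T_analytic T_real by simp
qed

definition "\<rho> = (real K - 1/2) / real K"

lemma \<rho>: "0 \<le> \<rho>" "\<rho> < 1"
  using K_ge2 by (auto simp: \<rho>_def)

lemma iterate_step:
  assumes "y \<in> J" "c \<in> V"
  shows "norm (iterate (Suc n) y c - iterate n y c) \<le> \<rho> ^ n * (hi - lo + 2 * e)"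
  using assms(1)
proof (induction n arbitrary: y)
  case 0
  have b: "iterate n y c \<in> rect" for n
    using iterate_props[of n] 0 assms(2) by (auto simp: admissible_def)
  have "norm (iterate 1 y c - iterate 0 y c) \<le>
    \<bar>Re (iterate 1 y c - iterate 0 y c)\<bar> + \<bar>Im (iterate 1 y c - iterate 0 y c)\<bar>"
    by (rule cmod_le)
  also have "\<dots> \<le> hi - lo + 2 * e"
    using b[of 1] b[of 0] e_pos unfolding rect_def by (auto simp: abs_le_iff)
  finally show ?case by simp
next
  case (Suc n)
  have "norm (T (iterate (Suc n)) y c - T (iterate n) y c) \<le> \<rho> * (\<rho> ^ n * (hi - lo + 2 * e))"
    unfolding \<rho>_def using Suc assms(2) iterate_props[of n] iterate_props[of "Suc n"]
    by (intro T_contraction) (auto simp: \<rho>_def)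
  then show ?case by simp
qed

text \<open>
  The iterates converge geometrically, uniformly in \<open>(y, c)\<close>, so continuity in \<open>(y, c)\<close> and holomorphy in \<open>c\<close> pass to
  the limit, and the limit solves the integral equation.
\<close>

lemma fixed_point:
  obtains r where "\<And>y. y \<in> J \<Longrightarrow> r y holomorphic_on V"
    and "admissible r" and "real_on_reals r"
    and "\<And>y c. y \<in> J \<Longrightarrow> c \<in> V \<Longrightarrow> T r y c = r y c"
proof -
  have "uniformly_convergent_on (J \<times> V)
    (\<lambda>n p. \<Sum>i<n. iterate (Suc i) (fst p) (snd p) - iterate i (fst p) (snd p))"
  proof (rule Weierstrass_m_test')
    show "summable (\<lambda>n. \<rho> ^ n * (hi - lo + 2 * e))"
      using \<rho> by (intro summable_mult2 summable_geometric) auto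
  qed (use iterate_step in auto)
  moreover have "(\<Sum>i<n. iterate (Suc i) (fst p) (snd p) - iterate i (fst p) (snd p))
      = iterate n (fst p) (snd p) - of_real lo" for n p
    using sum_lessThan_telescope[of "\<lambda>i. iterate i (fst p) (snd p)" n] by simp
  ultimately obtain s where s: "uniform_limit (J \<times> V) (\<lambda>n p. iterate n (fst p) (snd p) - of_real lo) s sequentially"
    unfolding uniformly_convergent_on_def by auto
  define r where "r y c = s (y, c) + of_real lo" for y c
  have "uniform_limit (J \<times> V) (\<lambda>n p. (iterate n (fst p) (snd p) - of_real lo) + of_real lo)
     (\<lambda>p. s p + of_real lo) sequentially"
    by (intro uniform_limit_intros s)
  then have lim: "uniform_limit (J \<times> V) (\<lambda>n p. iterate n (fst p) (snd p)) (\<lambda>p. r (fst p) (snd p)) sequentially"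
    by (simp add: r_def)
  have ptw: "(\<lambda>n. iterate n y c) \<longlonglongrightarrow> r y c" if "y \<in> J" "c \<in> V" for y c
    using tendsto_uniform_limitI[OF lim, of "(y, c)"] that by simp
  have "continuous_on (J \<times> V) (\<lambda>p. r (fst p) (snd p))"
    by (rule uniform_limit_theorem[OF _ lim])
      (use iterate_props in \<open>auto simp: admissible_def split_beta\<close>)
  moreover have "r y c \<in> rect" if "y \<in> J" "c \<in> V" for y c
    by (rule Lim_in_closed_set[OF rect_closed _ _ ptw[OF that]])
      (use iterate_props that in \<open>auto simp: admissible_def\<close>)
  ultimately have adm: "admissible r" by (auto simp: admissible_def split_beta)
  have real: "real_on_reals r"
    unfolding real_on_reals_def
  proof safe
    fix y c assume *: "y \<in> J" "c \<in> V" "Im c = 0"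
    have "(\<lambda>n. Im (iterate n y c)) \<longlonglongrightarrow> Im (r y c)" using * by (intro tendsto_Im ptw)
    moreover have "Im (iterate n y c) = 0" for n
      using iterate_props[of n] * by (auto simp: real_on_reals_def)
    ultimately show "Im (r y c) = 0" by (simp add: LIMSEQ_const_iff)
  qed
  have hol: "r y holomorphic_on V" if y: "y \<in> J" for y
  proof (rule holomorphic_uniform_sequence[OF V_open])
    fix n show "iterate n y holomorphic_on V"
      using iterate_props[of n] y unfolding analytic_in_c_def holomorphic_on_def field_differentiable_def
      by blast
  next
    fix x assume "x \<in> V"
    then obtain d where d: "0 < d" "cball x d \<subseteq> V" using V_open open_contains_cball by blast
    have "uniform_limit (cball x d) (\<lambda>n c. iterate n y c) (\<lambda>c. r y c) sequentially"
      unfolding uniform_limit_iff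
    proof safe
      fix \<epsilon> :: real assume "\<epsilon> > 0"
      then have "\<forall>\<^sub>F n in sequentially. \<forall>p\<in>J \<times> V. dist (iterate n (fst p) (snd p)) (r (fst p) (snd p)) < \<epsilon>"
        using lim by (auto simp: uniform_limit_iff)
      then show "\<forall>\<^sub>F n in sequentially. \<forall>c\<in>cball x d. dist (iterate n y c) (r y c) < \<epsilon>"
        by eventually_elim (use y d in force)
    qed
    then show "\<exists>d>0. cball x d \<subseteq> V \<and> uniform_limit (cball x d) (\<lambda>n. iterate n y) (r y) sequentially"
      using d by blast
  qed
  have "T r y c = r y c" if y: "y \<in> J" and c: "c \<in> V" for y c
  proof -
    have "(\<lambda>n. iterate (Suc n) y c) \<longlonglongrightarrow> T r y c"
      unfolding tendsto_iff
    proof safe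
      fix \<epsilon> :: real assume e: "\<epsilon> > 0"
      then have "\<forall>\<^sub>F n in sequentially. \<forall>p\<in>J \<times> V. dist (iterate n (fst p) (snd p)) (r (fst p) (snd p)) < \<epsilon>"
        using lim by (auto simp: uniform_limit_iff)
      then show "\<forall>\<^sub>F n in sequentially. dist (iterate (Suc n) y c) (T r y c) < \<epsilon>"
      proof eventually_elim
        case (elim n)
        have "norm (T (iterate n) y c - T r y c) \<le> \<rho> * \<epsilon>"
          unfolding \<rho>_def using iterate_props adm y c elim
          by (intro T_contraction) (auto simp: dist_norm intro!: less_imp_le)
        also have "\<dots> < \<epsilon>" using \<rho> e by simp
        finally show ?case by (simp add: dist_norm)
      qed
    qed
    moreover have "(\<lambda>n. iterate (Suc n) y c) \<longlonglongrightarrow> r y c"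
      using ptw[OF y c] by (rule LIMSEQ_Suc)
    ultimately show ?thesis using LIMSEQ_unique by blast
  qed
  with hol adm real that show thesis by blast
qed

end

section \<open>Slope profiles\<close>

text \<open>
  \<open>y * r y\<close> is the slope \<open>\<theta>\<^sub>x\<close> on the stable curve at distance \<open>y\<close> from the rest state, and the
  equation is \<open>p * p' = F - c * p\<close> divided by \<open>p = y * r y\<close>. Dividing out the factor \<open>y\<close> makes
  the equation regular at the rest state.
\<close>

definition slope :: "(real \<Rightarrow> real) \<Rightarrow> real set \<Rightarrow> real \<Rightarrow> (real \<Rightarrow> real) \<Rightarrow> bool" where
  "slope f J c r \<longleftrightarrow> continuous_on J r \<and>
    (\<forall>y\<in>J. 0 < r y \<and> ((\<lambda>y. y * r y) has_real_derivative f y / r y - c) (at y within J))"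

lemma DERIV_chain_subset:
  assumes "(f has_field_derivative D) (at (g x) within T)" "g ` S \<subseteq> T"
    and "(g has_field_derivative E) (at x within S)"
  shows "((\<lambda>x. f (g x)) has_field_derivative D * E) (at x within S)"
  using DERIV_image_chain[OF has_field_derivative_subset[OF assms(1,2)] assms(3)]
  by (simp add: o_def)

context slope_box
begin

text \<open>
  Substituting \<open>s = t * y\<close> turns the integral equation into \<open>y ^ K * r y = A y - A 0\<close>, where \<open>A\<close> is an
  antiderivative of the kernel; differentiating gives the equation away from \<open>0\<close>. At \<open>0\<close> the derivative of
  \<open>y * r y\<close> is \<open>r 0\<close> by continuity, and the integral equation at \<open>0\<close> reads \<open>r 0 = f 0 / r 0 - c\<close>.
\<close>

lemma real_fixed_point_slope:
  assumes r: "continuous_on J r" "\<And>y. y \<in> J \<Longrightarrow> 0 < r y"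
    and fp: "\<And>y. y \<in> J \<Longrightarrow>
      ((\<lambda>t. t ^ (K - 1) * ((real K - 1) * r (t * y) + f (t * y) / r (t * y) - c)) has_integral r y) {0..1}"
  shows "slope f J c r"
proof -
  define \<phi> where "\<phi> y = (real K - 1) * r y + f y / r y - c" for y
  have \<phi>_cont: "continuous_on J \<phi>"
    unfolding \<phi>_def
    by (intro continuous_on_diff continuous_on_add continuous_on_mult continuous_on_divide
        continuous_on_const r(1) f_cont) (use r(2) in force)
  then have "continuous_on J (\<lambda>y. y ^ (K - 1) * \<phi> y)" by (intro continuous_intros)
  then obtain A where A: "\<And>y. y \<in> J \<Longrightarrow> (A has_real_derivative y ^ (K - 1) * \<phi> y) (at y within J)"
    using antiderivative_continuous[of l h "\<lambda>y. y ^ (K - 1) * \<phi> y"]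
    unfolding has_real_derivative_iff_has_vector_derivative by blast
  obtain k where k: "K = Suc k" using K_ge2 by (cases K) auto
  have int: "y ^ K * r y = A y - A 0" if y: "y \<in> J" for y
  proof -
    have I1: "((\<lambda>t. (t * y) ^ (K - 1) * \<phi> (t * y) * y) has_integral A (1 * y) - A (0 * y)) {0..1}"
    proof (rule fundamental_theorem_of_calculus)
      fix t :: real assume t: "t \<in> {0..1}"
      have "((\<lambda>t. A (t * y)) has_real_derivative (t * y) ^ (K - 1) * \<phi> (t * y) * y) (at t within {0..1})"
        by (rule DERIV_chain_subset[where f = A and g = "\<lambda>t. t * y", OF A[OF scale_J[OF y t]]])
          (use scale_J[OF y] in \<open>auto intro!: derivative_eq_intros simp del: atLeastAtMost_iff\<close>)
      then show "((\<lambda>t. A (t * y)) has_vector_derivative (t * y) ^ (K - 1) * \<phi> (t * y) * y) (at t within {0..1})"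
        by (simp add: has_real_derivative_iff_has_vector_derivative)
    qed simp
    have I2: "((\<lambda>t. y ^ K * (t ^ (K - 1) * \<phi> (t * y))) has_integral y ^ K * r y) {0..1}"
      unfolding \<phi>_def by (rule has_integral_mult_right[OF fp[OF y]])
    have I12: "(\<lambda>t. y ^ K * (t ^ (K - 1) * \<phi> (t * y))) = (\<lambda>t. (t * y) ^ (K - 1) * \<phi> (t * y) * y)"
      by (auto simp: k power_mult_distrib fun_eq_iff)
    show ?thesis using has_integral_unique[OF I1 I2[unfolded I12]] by simp
  qed
  have zero: "0 \<in> J" using lh by simp
  have "((\<lambda>y. y * r y) has_real_derivative f y / r y - c) (at y within J)" if y: "y \<in> J" for y
  proof (cases "y = 0")
    case False
    have r_eq: "r y = (A y - A 0) / y ^ K" using int[OF y] False by (simp add: field_simps)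
    have "((\<lambda>y. y * ((A y - A 0) / y ^ K)) has_real_derivative f y / r y - c) (at y within J)"
    proof -
      have "((\<lambda>y. y * ((A y - A 0) / y ^ K)) has_real_derivative
        1 * ((A y - A 0) / y ^ K) + ((y ^ (K - 1) * \<phi> y - 0) * y ^ K - (A y - A 0) * (real K * (1 * y ^ (K - Suc 0))))
          / (y ^ K * y ^ K) * y) (at y within J)"
        using False by (intro derivative_intros A y) auto
      moreover have "1 * ((A y - A 0) / y ^ K) + ((y ^ (K - 1) * \<phi> y - 0) * y ^ K - (A y - A 0) * (real K * (1 * y ^ (K - Suc 0))))
          / (y ^ K * y ^ K) * y = f y / r y - c"
      proof -
        have A_diff: "A y - A 0 = y ^ K * r y" using int[OF y] by simp
        have N: "(y ^ (K - 1) * \<phi> y - 0) * y ^ K - (A y - A 0) * (real K * (1 * y ^ (K - Suc 0)))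
            = y ^ k * (y ^ K * (\<phi> y - real K * r y))"
          unfolding A_diff by (simp add: k algebra_simps)
        have Q: "y ^ k * (y ^ K * w) / (y ^ K * y ^ K) * y = w" for w
          using False by (simp add: k)
        show ?thesis unfolding N Q r_eq[symmetric] by (simp add: \<phi>_def algebra_simps)
      qed
      ultimately show ?thesis by simp
    qed
    then show ?thesis
      by (rule has_field_derivative_transform_within[where d = "\<bar>y\<bar>"])
        (use False y int[symmetric] in \<open>auto simp: dist_real_def\<close>)
  next
    case True
    have "((\<lambda>t. t ^ (K - 1) * \<phi> 0) has_integral r 0) {0..1}"
      using fp[OF zero] by (simp add: \<phi>_def)
    then have "r 0 = \<phi> 0 / real K" using weight_integral has_integral_unique by blast
    then have eq: "f 0 / r 0 - c = r 0"
      using K_ge2 by (simp add: \<phi>_def field_simps)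
    have "(r \<longlongrightarrow> r 0) (at 0 within J)"
      using r(1) zero by (simp add: continuous_on_def)
    then have "((\<lambda>y. (y * r y - 0 * r 0) / (y - 0)) \<longlongrightarrow> r 0) (at 0 within J)"
      by (rule Lim_transform_eventually) (auto simp: eventually_at_filter)
    then show ?thesis
      unfolding True eq has_field_derivative_iff by simp
  qed
  then show ?thesis using r by (auto simp: slope_def)
qed

lemma analytic_slope:
  "\<exists>r. (\<forall>y\<in>J. r y holomorphic_on V) \<and>
    (\<forall>y\<in>J. \<forall>c. \<bar>c\<bar> < C \<longrightarrow> Im (r y (of_real c)) = 0) \<and>
    (\<forall>c. \<bar>c\<bar> < C \<longrightarrow> slope f J c (\<lambda>y. Re (r y (of_real c))))"
proof -
  obtain r where r: "\<And>y. y \<in> J \<Longrightarrow> r y holomorphic_on V" "admissible r" "real_on_reals r"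
    "\<And>y c. y \<in> J \<Longrightarrow> c \<in> V \<Longrightarrow> T r y c = r y c"
    using fixed_point by blast
  have V: "complex_of_real c \<in> V" if "\<bar>c\<bar> < C" for c using that e_pos by (simp add: V_def)
  have Im: "Im (r y (of_real c)) = 0" if "y \<in> J" "\<bar>c\<bar> < C" for y c
    using r(3) V that unfolding real_on_reals_def by force
  have "slope f J c (\<lambda>y. Re (r y (of_real c)))" if c: "\<bar>c\<bar> < C" for c
  proof (rule real_fixed_point_slope)
    have "continuous_on J (\<lambda>y. Re ((\<lambda>(y, c). r y c) (y, of_real c)))"
      by (intro continuous_on_Re continuous_on_compose2[OF admissibleD(1)[OF r(2)]])
        (use V[OF c] in \<open>auto intro!: continuous_intros\<close>)
    then show "continuous_on J (\<lambda>y. Re (r y (of_real c)))" by simp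
    show "0 < Re (r y (of_real c))" if "y \<in> J" for y
      using admissibleD(2)[OF r(2) that V[OF c]] lo_pos by (simp add: rect_def)
    show "((\<lambda>t. t ^ (K - 1) * ((real K - 1) * Re (r (t * y) (of_real c)) + f (t * y) / Re (r (t * y) (of_real c)) - c))
        has_integral Re (r y (of_real c))) {0..1}" if y: "y \<in> J" for y
    proof -
      have I: "((\<lambda>t. Re (of_real (t ^ (K - 1)) * \<Phi> (t * y) (r (t * y) (of_real c)) (of_real c)))
        has_integral Re (r y (of_real c))) {0..1}"
        using has_integral_linear[OF T_has_integral[OF r(2) y V[OF c]] bounded_linear_Re]
        by (simp add: o_def r(4)[OF y V[OF c]])
      show ?thesis
      proof (rule has_integral_eq[OF _ I])
        fix t :: real assume t: "t \<in> {0..1}"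
        have "r (t * y) (of_real c) = of_real (Re (r (t * y) (of_real c)))"
          using Im[OF scale_J[OF y t] c] by (simp add: complex_eq_iff)
        then obtain s where s: "r (t * y) (of_real c) = of_real s" by blast
        show "Re (of_real (t ^ (K - 1)) * \<Phi> (t * y) (r (t * y) (of_real c)) (of_real c)) =
          t ^ (K - 1) * ((real K - 1) * Re (r (t * y) (of_real c)) + f (t * y) / Re (r (t * y) (of_real c)) - c)"
          unfolding s \<Phi>_def by (simp del: of_real_power)
      qed
    qed
  qed
  then show ?thesis using r(1) Im by (intro exI[of _ r]) simp
qed

end

text \<open>
  The constants of the integral equation can be chosen for any positive continuous \<open>f\<close> and any bound on
  the speed.
\<close>

lemma slope_family:
  assumes lh: "l \<le> 0" "0 \<le> h" and f: "continuous_on {l..h} f" "\<And>y. y \<in> {l..h} \<Longrightarrow> 0 < f y"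
    and C: "0 < C"
  shows "\<exists>e r. 0 < e \<and>
    (\<forall>y\<in>{l..h}. r y holomorphic_on {c. \<bar>Re c\<bar> < C \<and> \<bar>Im c\<bar> < e}) \<and>
    (\<forall>y\<in>{l..h}. \<forall>c. \<bar>c\<bar> < C \<longrightarrow> Im (r y (of_real c)) = 0) \<and>
    (\<forall>c. \<bar>c\<bar> < C \<longrightarrow> slope f {l..h} c (\<lambda>y. Re (r y (of_real c))))"
proof -
  have ne: "compact {l..h}" "{l..h} \<noteq> {}" using lh by auto
  obtain y1 y2 where y1: "y1 \<in> {l..h}" "\<And>y. y \<in> {l..h} \<Longrightarrow> f y1 \<le> f y"
    and y2: "y2 \<in> {l..h}" "\<And>y. y \<in> {l..h} \<Longrightarrow> f y \<le> f y2"
    using continuous_attains_inf[OF ne f(1)] continuous_attains_sup[OF ne f(1)] by blast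
  define m M where "m = f y1" and "M = f y2"
  have m: "0 < m" "0 < M" using f(2) y1 y2 by (auto simp: m_def M_def)
  \<comment> \<open>\<open>lo\<close> and \<open>hi\<close> are barriers for all \<open>\<bar>c\<bar> < C\<close>; \<open>K\<close> dominates the sum of the lower bounds required of it.\<close>
  define lo hi where "lo = min 1 (m / (4 * (1 + C)))" and "hi = 2 * M + C + 1"
  have lo: "0 < lo" "lo \<le> 1" "lo * (4 * (1 + C)) \<le> m"
  proof -
    show "0 < lo" "lo \<le> 1" using m C by (auto simp: lo_def)
    have "lo \<le> m / (4 * (1 + C))" by (simp add: lo_def)
    then show "lo * (4 * (1 + C)) \<le> m" using C by (subst (asm) pos_le_divide_eq) auto
  qed
  obtain K :: nat where K: "2 + C / lo + (M / lo + C) * (2 / hi) + (1 + M / lo\<^sup>2) + (1 + (M / lo\<^sup>2)\<^sup>2) \<le> real K"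
    using real_arch_simple by blast
  have hi: "1 \<le> hi" using m C by (simp add: hi_def)
  have nn: "0 \<le> C / lo" "0 \<le> (M / lo + C) * (2 / hi)" "0 \<le> M / lo\<^sup>2" "0 \<le> (M / lo\<^sup>2)\<^sup>2"
    using m C lo hi by (auto intro!: mult_nonneg_nonneg)
  interpret slope_box f l h m M lo hi lo C K
  proof
    have "4 * lo * (lo + C) \<le> 4 * lo * (1 + C)" using lo by (intro mult_left_mono) auto
    also have "\<dots> = lo * (4 * (1 + C))" by simp
    finally show "4 * lo * (lo + C) \<le> m" using lo(3) by linarith
    show "2 * M / hi + C \<le> hi"
    proof -
      have "2 * M / hi \<le> 2 * M / 1" using hi m by (intro divide_left_mono) auto
      then show ?thesis by (simp add: hi_def)
    qed
    have "C / lo \<le> real K - 2" using K nn by linarith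
    then show "C \<le> (real K - 2) * lo" using lo by (simp add: field_simps)
    have "(M / lo + C) * (2 / hi) \<le> real K" using K nn by linarith
    then show "M / lo + C \<le> real K * (hi / 2)" using hi by (simp add: field_simps)
    show "1 + M / lo\<^sup>2 \<le> real K" "1 + (M / lo\<^sup>2)\<^sup>2 \<le> real K" using K nn by linarith+
  qed (use lh f y1 y2 m lo hi C in \<open>auto simp: m_def M_def\<close>)
  show ?thesis
    using analytic_slope lo(1) unfolding V_def by (intro exI[of _ lo]) simp
qed

lemma slope_subset: "slope f J c r \<Longrightarrow> J' \<subseteq> J \<Longrightarrow> slope f J' c r"
  unfolding slope_def by (meson continuous_on_subset has_field_derivative_subset subsetD)

lemma slope_continuous: "slope f J c r \<Longrightarrow> continuous_on J (\<lambda>y. y * r y)"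
  unfolding slope_def by (auto intro: DERIV_continuous_on)

text \<open>
  At a negative minimum of the difference \<open>w = y * r y - y * s y\<close> one has \<open>r < s\<close>, hence
  \<open>w' = f / r - f / s + (c' - c) > 0\<close>, so that \<open>w\<close> is still smaller slightly to the left. For \<open>c = c'\<close>
  this yields uniqueness of profiles.
\<close>

lemma slope_antimono:
  assumes r: "slope f {0..h} c r" and s: "slope f {0..h} c' s" and c: "c \<le> c'"
    and f: "\<And>y. y \<in> {0..h} \<Longrightarrow> 0 < f y" and y: "y \<in> {0..h}"
  shows "y * s y \<le> y * r y"
proof (rule ccontr)
  assume neg: "\<not> y * s y \<le> y * r y"
  define w where "w y = y * r y - y * s y" for y
  have "continuous_on {0..h} w"
    unfolding w_def by (intro continuous_on_diff slope_continuous[OF r] slope_continuous[OF s])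
  then obtain y0 where y0: "y0 \<in> {0..h}" "\<And>y. y \<in> {0..h} \<Longrightarrow> w y0 \<le> w y"
    using continuous_attains_inf[of "{0..h}" w] y by auto
  have "w y0 < 0" using y0(2)[OF y] neg by (simp add: w_def)
  then have "y0 \<noteq> 0" by (auto simp: w_def)
  then have "0 < y0" using y0(1) by simp
  have pos: "0 < r y0" "0 < s y0" "r y0 < s y0"
    using r s y0(1) \<open>w y0 < 0\<close> \<open>0 < y0\<close> by (auto simp: slope_def w_def)
  have "(w has_real_derivative (f y0 / r y0 - c) - (f y0 / s y0 - c')) (at y0 within {0..h})"
    unfolding w_def using r s y0(1) by (intro DERIV_diff) (auto simp: slope_def)
  moreover have "f y0 / s y0 < f y0 / r y0"
    using f[OF y0(1)] pos by (intro divide_strict_left_mono) auto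
  then have "0 < (f y0 / r y0 - c) - (f y0 / s y0 - c')" using c by linarith
  ultimately obtain d where d: "0 < d" "\<And>t. 0 < t \<Longrightarrow> y0 - t \<in> {0..h} \<Longrightarrow> t < d \<Longrightarrow> w (y0 - t) < w y0"
    using has_real_derivative_pos_inc_left by blast
  define t where "t = min (d / 2) y0"
  have t: "0 < t" "t < d" "y0 - t \<in> {0..h}" using d(1) \<open>0 < y0\<close> y0(1) by (auto simp: t_def min_def)
  then show False using d(2)[of t] y0(2)[of "y0 - t"] by auto
qed

lemma slope_unique:
  assumes "slope f {0..h} c r" "slope f {0..h} c s" "\<And>y. y \<in> {0..h} \<Longrightarrow> 0 < f y" "y \<in> {0..h}"
  shows "y * r y = y * s y"
  using slope_antimono[OF assms(1,2) order_refl assms(3,4)]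
    slope_antimono[OF assms(2,1) order_refl assms(3,4)] by auto

text \<open>
  At a positive maximum the derivative \<open>f y / r y - c\<close> cannot be negative, so
  \<open>y * r y \<le> y * f y / c\<close> there.
\<close>

lemma slope_bound:
  assumes r: "slope f {0..h} c r" and c: "0 < c" and B: "\<And>y. y \<in> {0..h} \<Longrightarrow> y * f y \<le> B" "0 \<le> B"
    and y: "y \<in> {0..h}"
  shows "y * r y \<le> B / c"
proof -
  obtain y0 where y0: "y0 \<in> {0..h}" "\<And>y. y \<in> {0..h} \<Longrightarrow> y * r y \<le> y0 * r y0"
    using continuous_attains_sup[of "{0..h}" "\<lambda>y. y * r y"] slope_continuous[OF r] y by auto
  have "y0 * r y0 \<le> B / c"
  proof (rule ccontr)
    assume "\<not> ?thesis"
    then have gt: "B / c < y0 * r y0" by simp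
    then have "y0 \<noteq> 0" using B(2) c by (auto simp: divide_less_0_iff)
    then have "0 < y0" using y0(1) by simp
    have r0: "0 < r y0" using r y0 by (auto simp: slope_def)
    have "y0 * f y0 < c * (y0 * r y0)"
      using gt B(1)[OF y0(1)] c by (simp add: field_simps)
    then have "f y0 / r y0 - c < 0" using \<open>0 < y0\<close> r0 by (simp add: field_simps)
    moreover have "((\<lambda>y. y * r y) has_real_derivative f y0 / r y0 - c) (at y0 within {0..h})"
      using r y0 by (auto simp: slope_def)
    ultimately obtain d where d: "0 < d"
      "\<And>t. 0 < t \<Longrightarrow> y0 - t \<in> {0..h} \<Longrightarrow> t < d \<Longrightarrow> y0 * r y0 < (y0 - t) * r (y0 - t)"
      using has_real_derivative_neg_dec_left by blast
    define t where "t = min (d / 2) y0"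
    have t: "0 < t" "t < d" "y0 - t \<in> {0..h}" using d(1) \<open>0 < y0\<close> y0(1) by (auto simp: t_def min_def)
    then show False using d(2)[of t] y0(2)[of "y0 - t"] by auto
  qed
  then show ?thesis using y0(2)[OF y] by linarith
qed

text \<open>
  \<open>2 * A y - (y * r y)\<^sup>2\<close> is the energy lost to the friction term; its derivative is \<open>2 * c * (y * r y) > 0\<close>.
\<close>

lemma slope_energy:
  assumes r: "slope f {0..h} c r" and c: "0 < c" and h: "0 < h"
    and A: "\<And>y. y \<in> {0..h} \<Longrightarrow> (A has_real_derivative y * f y) (at y within {0..h})"
  shows "(h * r h)\<^sup>2 < 2 * (A h - A 0)"
proof -
  define E where "E y = 2 * A y - (y * r y)\<^sup>2" for y
  have der: "(E has_real_derivative 2 * c * (y * r y)) (at y within {0..h})" if y: "y \<in> {0..h}" for y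
  proof -
    have r': "0 < r y" "((\<lambda>y. y * r y) has_real_derivative f y / r y - c) (at y within {0..h})"
      using r y by (auto simp: slope_def)
    have "(E has_real_derivative 2 * (y * f y) - of_nat 2 * ((f y / r y - c) * (y * r y) ^ (2 - Suc 0))) (at y within {0..h})"
      unfolding E_def by (intro derivative_intros r' DERIV_cmult A y)
    moreover have "2 * (y * f y) - of_nat 2 * ((f y / r y - c) * (y * r y) ^ (2 - Suc 0)) = 2 * c * (y * r y)"
      using r'(1) by (simp add: field_simps)
    ultimately show ?thesis by simp
  qed
  have "E 0 < E h"
  proof (rule DERIV_pos_imp_increasing_open[OF h])
    fix y assume y: "0 < y" "y < h"
    then have "0 < r y" using r by (auto simp: slope_def)
    then show "\<exists>D. (E has_real_derivative D) (at y) \<and> 0 < D"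
      using der[of y] y c by (intro exI[of _ "2 * c * (y * r y)"]) (simp add: at_within_Icc_at)
  next
    show "continuous_on {0..h} E" by (rule DERIV_continuous_on[OF der])
  qed
  then show ?thesis by (simp add: E_def)
qed

section \<open>The slope at the end of the stable curve\<close>

text \<open>
  By \<open>slope_unique\<close> the value does not depend on the profile chosen.
\<close>

definition exit_slope :: "(real \<Rightarrow> real) \<Rightarrow> real \<Rightarrow> real \<Rightarrow> real" where
  "exit_slope f h c = h * (SOME r. slope f {0..h} c r) h"

locale slope_problem =
  fixes f :: "real \<Rightarrow> real" and h :: real
  assumes h: "0 < h" and f_cont: "continuous_on {0..h} f"
    and f_pos: "\<And>y. y \<in> {0..h} \<Longrightarrow> 0 < f y"
begin

lemma exit_slope_eq:
  assumes "slope f J c r" "{0..h} \<subseteq> J"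
  shows "exit_slope f h c = h * r h"
proof -
  have r: "slope f {0..h} c r" using assms by (rule slope_subset)
  then have "slope f {0..h} c (SOME r. slope f {0..h} c r)" by (rule someI[of "slope f {0..h} c"])
  from slope_unique[OF this r f_pos, of h] show ?thesis
    using h by (simp add: exit_slope_def)
qed

lemma exit_slope_obtain:
  obtains r where "slope f {0..h} c r" "exit_slope f h c = h * r h"
proof -
  have "0 < \<bar>c\<bar> + 1" by simp
  from slope_family[OF order_refl less_imp_le[OF h] f_cont f_pos this]
  obtain r where "\<And>b. \<bar>b\<bar> < \<bar>c\<bar> + 1 \<Longrightarrow> slope f {0..h} b (\<lambda>y. Re (r y (complex_of_real b)))"
    by blast
  then have "slope f {0..h} c (\<lambda>y. Re (r y (complex_of_real c)))" by simp
  then show thesis using that exit_slope_eq[OF _ order_refl] by blast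
qed

lemma exit_slope_pos: "0 < exit_slope f h c"
proof -
  obtain r where "slope f {0..h} c r" "exit_slope f h c = h * r h" by (rule exit_slope_obtain)
  then show ?thesis using h by (auto simp: slope_def)
qed

lemma exit_slope_antimono: "c \<le> c' \<Longrightarrow> exit_slope f h c' \<le> exit_slope f h c"
proof -
  assume c: "c \<le> c'"
  obtain r where r: "slope f {0..h} c r" "exit_slope f h c = h * r h" by (rule exit_slope_obtain)
  obtain s where s: "slope f {0..h} c' s" "exit_slope f h c' = h * s h" by (rule exit_slope_obtain)
  show ?thesis using slope_antimono[OF r(1) s(1) c f_pos, of h] h r(2) s(2) by simp
qed

lemma exit_slope_tendsto_0: "((\<lambda>c. exit_slope f h c) \<longlongrightarrow> 0) at_top"
proof -
  have "continuous_on {0..h} (\<lambda>y. y * f y)" by (intro continuous_intros f_cont)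
  then obtain y0 where y0: "y0 \<in> {0..h}" "\<And>y. y \<in> {0..h} \<Longrightarrow> y * f y \<le> y0 * f y0"
    using continuous_attains_sup[of "{0..h}" "\<lambda>y. y * f y"] h by auto
  have B: "0 \<le> y0 * f y0" using y0(1) f_pos[OF y0(1)] by simp
  have "exit_slope f h c \<le> y0 * f y0 / c" if "0 < c" for c
  proof -
    obtain r where r: "slope f {0..h} c r" "exit_slope f h c = h * r h" by (rule exit_slope_obtain)
    show ?thesis using slope_bound[OF r(1) that y0(2) B, of h] h r(2) by simp
  qed
  then have ev: "\<forall>\<^sub>F c in at_top. exit_slope f h c \<le> y0 * f y0 / c"
    by (rule eventually_mono[OF eventually_gt_at_top])
  have "((\<lambda>c. y0 * f y0 / c) \<longlongrightarrow> 0) at_top"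
    by (intro tendsto_divide_0[OF tendsto_const] filterlim_at_top_imp_at_infinity filterlim_ident)
  moreover have "\<forall>\<^sub>F c in at_top. 0 \<le> exit_slope f h c"
    by (rule always_eventually) (auto intro: less_imp_le exit_slope_pos)
  ultimately show ?thesis using tendsto_sandwich[OF _ ev tendsto_const] by blast
qed

lemma exit_slope_analytic:
  "\<exists>U G. open U \<and> complex_of_real c0 \<in> U \<and> G holomorphic_on U \<and>
     (\<forall>c. complex_of_real c \<in> U \<longrightarrow> G (complex_of_real c) = complex_of_real (exit_slope f h c))"
proof -
  define C where "C = \<bar>c0\<bar> + 1"
  have "0 < C" by (simp add: C_def)
  from slope_family[OF order_refl less_imp_le[OF h] f_cont f_pos this]
  obtain e r where e: "0 < e"
    and r: "\<And>y. y \<in> {0..h} \<Longrightarrow> r y holomorphic_on {c. \<bar>Re c\<bar> < C \<and> \<bar>Im c\<bar> < e}"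
    "\<And>y c. y \<in> {0..h} \<Longrightarrow> \<bar>c\<bar> < C \<Longrightarrow> Im (r y (of_real c)) = 0"
    "\<And>c. \<bar>c\<bar> < C \<Longrightarrow> slope f {0..h} c (\<lambda>y. Re (r y (of_real c)))"
    by blast
  define U where "U = {c. \<bar>Re c\<bar> < C \<and> \<bar>Im c\<bar> < e}"
  have hh: "h \<in> {0..h}" using h by simp
  have "U = {z. \<bar>Re z\<bar> < C} \<inter> {z. \<bar>Im z\<bar> < e}" by (auto simp: U_def)
  then have "open U" by (auto intro!: open_Int open_Collect_less continuous_intros)
  moreover have "complex_of_real c0 \<in> U" using e by (simp add: U_def C_def)
  moreover have "(\<lambda>c. of_real h * r h c) holomorphic_on U"
    using r(1)[OF hh] unfolding U_def by (intro holomorphic_intros)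
  moreover have "of_real h * r h (of_real c) = complex_of_real (exit_slope f h c)" if "of_real c \<in> U" for c
  proof -
    have c: "\<bar>c\<bar> < C" using that by (simp add: U_def)
    show ?thesis using exit_slope_eq[OF r(3)[OF c] order_refl] r(2)[OF hh c]
      by (simp add: complex_eq_iff)
  qed
  ultimately show ?thesis by blast
qed

end

section \<open>Orbits and the stable curve\<close>

lemma at_within_atLeast_eq: "(R::real) < x \<Longrightarrow> at x within {R..} = at x"
  by (rule at_within_interior) (simp add: interior_real_atLeast)

text \<open>
  The distance \<open>z\<close> of the orbit from the stable curve satisfies a linear equation with positive
  coefficient, so \<open>z\<^sup>2\<close> is nondecreasing. If \<open>z\<close> were nonzero somewhere, then \<open>\<bar>\<theta>\<^sub>x\<bar>\<close> would stay away from \<open>0\<close>,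
  because \<open>y * r y\<close> tends to \<open>0\<close>, and the mean value theorem on intervals of length \<open>1\<close> contradicts
  the convergence of \<open>\<theta>\<close>.
\<close>

lemma solution_on_stable_curve:
  fixes \<theta> \<theta>1 \<theta>2 f r F :: "real \<Rightarrow> real"
  assumes d1: "\<And>x. x \<ge> R \<Longrightarrow> (\<theta> has_real_derivative \<theta>1 x) (at x within {R..})"
    and c1: "continuous_on {R..} \<theta>1"
    and d2: "\<And>x. x > R \<Longrightarrow> (\<theta>1 has_real_derivative \<theta>2 x) (at x)"
    and ode: "\<And>x. x > R \<Longrightarrow> \<theta>2 x - c * \<theta>1 x + F (\<theta> x) = 0"
    and lim: "(\<theta> \<longlongrightarrow> b) at_top"
    and r: "slope f J c r" and J: "\<And>x. x \<ge> R \<Longrightarrow> b - \<theta> x \<in> J" "0 \<in> J"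
    and f: "\<And>y. y \<in> J \<Longrightarrow> 0 < f y" "\<And>y. y \<in> J \<Longrightarrow> F (b - y) = y * f y"
    and x: "x \<ge> R"
  shows "\<theta>1 x = (b - \<theta> x) * r (b - \<theta> x)"
proof (rule ccontr)
  assume neq: "\<not> ?thesis"
  define p where "p y = y * r y" for y
  define z where "z x = \<theta>1 x - p (b - \<theta> x)" for x
  have p: "0 < r y" "(p has_real_derivative f y / r y - c) (at y within J)" if "y \<in> J" for y
    using r that by (auto simp: slope_def p_def[abs_def])
  have p_cont: "continuous_on J p" using slope_continuous[OF r] by (simp add: p_def)
  have z_der: "(z has_real_derivative f (b - \<theta> x) / r (b - \<theta> x) * z x) (at x)" if x: "x > R" for x
  proof -
    have xJ: "b - \<theta> x \<in> J" using J(1) x by simp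
    have yd: "((\<lambda>x. b - \<theta> x) has_real_derivative - \<theta>1 x) (at x within {R..})"
      using d1[of x] x by (auto intro!: derivative_eq_intros)
    have "((\<lambda>x. p (b - \<theta> x)) has_real_derivative (f (b - \<theta> x) / r (b - \<theta> x) - c) * - \<theta>1 x) (at x within {R..})"
      by (rule DERIV_chain_subset[where f = p and g = "\<lambda>x. b - \<theta> x", OF p(2)[OF xJ] _ yd]) (use J in auto)
    then have "((\<lambda>x. p (b - \<theta> x)) has_real_derivative (f (b - \<theta> x) / r (b - \<theta> x) - c) * - \<theta>1 x) (at x)"
      using at_within_atLeast_eq[OF x] by simp
    from DERIV_diff[OF d2[OF x] this]
    have "(z has_real_derivative \<theta>2 x - (f (b - \<theta> x) / r (b - \<theta> x) - c) * - \<theta>1 x) (at x)"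
      by (simp add: z_def[abs_def])
    moreover have "\<theta>2 x = c * \<theta>1 x - (b - \<theta> x) * f (b - \<theta> x)"
      using ode[OF x] f(2)[OF xJ] by simp
    ultimately show ?thesis
      using p(1)[OF xJ] by (simp add: z_def p_def field_simps)
  qed
  have \<theta>_cont: "continuous_on {R..} \<theta>" by (rule DERIV_continuous_on[OF d1]) simp
  have z_cont: "continuous_on {R..} z"
    unfolding z_def
    by (intro continuous_on_diff c1 continuous_on_compose2[OF p_cont] continuous_on_const \<theta>_cont)
      (use J in auto)
  have grow: "(z x)\<^sup>2 \<le> (z t)\<^sup>2" if "x \<le> t" for t
  proof (rule DERIV_nonneg_imp_increasing_open[OF that])
    fix s assume s: "x < s" "s < t"
    then have sR: "s > R" using x by simp
    have "((\<lambda>x. (z x)\<^sup>2) has_real_derivative 2 * (f (b - \<theta> s) / r (b - \<theta> s)) * (z s)\<^sup>2) (at s)"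
      by (rule derivative_eq_intros z_der[OF sR] refl)+ (simp add: power2_eq_square)
    moreover have "0 \<le> 2 * (f (b - \<theta> s) / r (b - \<theta> s)) * (z s)\<^sup>2"
      using f(1) p(1) J(1)[of s] sR by (simp add: less_imp_le)
    ultimately show "\<exists>D. ((\<lambda>x. (z x)\<^sup>2) has_real_derivative D) (at s) \<and> 0 \<le> D" by blast
  next
    show "continuous_on {x..t} (\<lambda>x. (z x)\<^sup>2)"
      by (intro continuous_on_power continuous_on_subset[OF z_cont]) (use x in auto)
  qed
  \<comment> \<open>From here on, \<open>\<bar>z\<bar>\<close> never falls below its value at the point of deviation.\<close>
  define \<delta> where "\<delta> = \<bar>z x\<bar>"
  have \<delta>: "0 < \<delta>" using neq by (simp add: \<delta>_def z_def p_def)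
  have zge: "\<delta> \<le> \<bar>z t\<bar>" if "x \<le> t" for t
    using grow[OF that] by (simp add: \<delta>_def abs_le_square_iff)
  have "((\<lambda>x. b - \<theta> x) \<longlongrightarrow> b - b) at_top" by (intro tendsto_intros lim)
  moreover have "\<forall>\<^sub>F x in at_top. b - \<theta> x \<in> J"
    by (rule eventually_mono[OF eventually_ge_at_top[of R]]) (rule J(1))
  ultimately have "((\<lambda>x. p (b - \<theta> x)) \<longlongrightarrow> p 0) at_top"
    using J(2) by (intro continuous_on_tendsto_compose[OF p_cont]) auto
  then have ev1: "\<forall>\<^sub>F x in at_top. \<bar>p (b - \<theta> x)\<bar> < \<delta> / 2"
    using \<delta> by (auto simp: tendsto_iff p_def dist_real_def dest: spec[of _ "\<delta> / 2"])
  have ev2: "\<forall>\<^sub>F x in at_top. \<bar>\<theta> x - b\<bar> < \<delta> / 8"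
    using lim \<delta> by (auto simp: tendsto_iff dist_real_def dest: spec[of _ "\<delta> / 8"])
  obtain X where X: "\<And>t. t \<ge> X \<Longrightarrow> \<bar>p (b - \<theta> t)\<bar> < \<delta> / 2" "\<And>t. t \<ge> X \<Longrightarrow> \<bar>\<theta> t - b\<bar> < \<delta> / 8"
    using eventually_conj[OF ev1 ev2] unfolding eventually_at_top_linorder by blast
  define X1 where "X1 = max X x + 1"
  have X1: "X \<le> X1" "x \<le> X1" "R < X1" using x by (auto simp: X1_def)
  have "(\<theta> has_real_derivative \<theta>1 t) (at t)" if "X1 \<le> t" for t
    using d1[of t] at_within_atLeast_eq[of R t] X1 that by simp
  then obtain \<xi> where \<xi>: "\<xi> > X1" "\<theta> (X1 + 1) - \<theta> X1 = (X1 + 1 - X1) * \<theta>1 \<xi>"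
    using MVT2[of X1 "X1 + 1" \<theta> \<theta>1] by auto
  have "\<bar>z \<xi>\<bar> \<ge> \<delta>" "\<bar>p (b - \<theta> \<xi>)\<bar> < \<delta> / 2" using zge[of \<xi>] X(1)[of \<xi>] \<xi>(1) X1 by auto
  then have "\<delta> / 2 < \<bar>\<theta>1 \<xi>\<bar>" unfolding z_def by linarith
  moreover have "\<theta> (X1 + 1) - \<theta> X1 = \<theta>1 \<xi>" using \<xi>(2) by simp
  moreover have "\<bar>\<theta> X1 - b\<bar> < \<delta> / 8" "\<bar>\<theta> (X1 + 1) - b\<bar> < \<delta> / 8" using X(2) X1 by auto
  ultimately show False using \<delta> by linarith
qed

lemma slope_lipschitz:
  assumes r: "slope f {l..h} c r" and f: "continuous_on {l..h} f"
  shows "\<exists>L. \<forall>y\<in>{l..h}. \<forall>y'\<in>{l..h}. \<bar>y * r y - y' * r y'\<bar> \<le> L * \<bar>y - y'\<bar>"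
proof -
  have "continuous_on {l..h} (\<lambda>y. f y / r y - c)"
    using r by (intro continuous_on_diff continuous_on_divide f continuous_on_const) (force simp: slope_def)+
  then have "bounded ((\<lambda>y. f y / r y - c) ` {l..h})"
    by (intro compact_imp_bounded compact_continuous_image) auto
  then obtain L where L: "0 < L" "\<And>y. y \<in> {l..h} \<Longrightarrow> \<bar>f y / r y - c\<bar> \<le> L"
    unfolding bounded_pos by auto
  have "\<bar>y * r y - y' * r y'\<bar> \<le> L * \<bar>y - y'\<bar>" if "y \<in> {l..h}" "y' \<in> {l..h}" for y y'
    using field_differentiable_bound[of "{l..h}" "\<lambda>y. y * r y" "\<lambda>y. f y / r y - c" L y y'] r L(2) that
    by (auto simp: slope_def)
  then show ?thesis by blast
qed

text \<open>
  Gronwall's argument for the square of the difference, weighted by \<open>exp (- 2 * L * x)\<close>.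
\<close>

lemma autonomous_unique:
  fixes \<theta> \<eta> P :: "real \<Rightarrow> real"
  assumes \<theta>: "\<And>x. x \<ge> R \<Longrightarrow> (\<theta> has_real_derivative P (\<theta> x)) (at x within {R..})"
    and \<eta>: "\<And>x. x \<ge> R \<Longrightarrow> (\<eta> has_real_derivative P (\<eta> x)) (at x within {R..})"
    and eq: "\<theta> R = \<eta> R" and L: "\<And>x. x \<ge> R \<Longrightarrow> \<bar>P (\<theta> x) - P (\<eta> x)\<bar> \<le> L * \<bar>\<theta> x - \<eta> x\<bar>"
    and x: "x \<ge> R"
  shows "\<theta> x = \<eta> x"
proof -
  define v where "v x = exp (- 2 * L * x) * (\<theta> x - \<eta> x)\<^sup>2" for x
  define v' where "v' x = 2 * exp (- 2 * L * x) * ((\<theta> x - \<eta> x) * (P (\<theta> x) - P (\<eta> x)) - L * (\<theta> x - \<eta> x)\<^sup>2)" for x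
  have der: "(v has_real_derivative v' x) (at x within {R..})" if "x \<ge> R" for x
    unfolding v_def v'_def
    by (rule derivative_eq_intros refl \<theta>[OF that] \<eta>[OF that])+ (simp add: power2_eq_square algebra_simps)
  have neg: "v' x \<le> 0" if "x \<ge> R" for x
  proof -
    have "(\<theta> x - \<eta> x) * (P (\<theta> x) - P (\<eta> x)) \<le> \<bar>\<theta> x - \<eta> x\<bar> * \<bar>P (\<theta> x) - P (\<eta> x)\<bar>"
      by (metis abs_ge_self abs_mult)
    also have "\<dots> \<le> \<bar>\<theta> x - \<eta> x\<bar> * (L * \<bar>\<theta> x - \<eta> x\<bar>)" using L[OF that] by (intro mult_left_mono) auto
    also have "\<dots> = L * (\<theta> x - \<eta> x)\<^sup>2" by (simp add: power2_eq_square abs_mult_self_eq mult.left_commute)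
    finally show ?thesis by (simp add: v'_def mult_nonneg_nonpos)
  qed
  have "v x \<le> v R"
  proof (rule DERIV_nonpos_imp_decreasing_open[OF x])
    fix t assume t: "R < t" "t < x"
    then show "\<exists>D. (v has_real_derivative D) (at t) \<and> D \<le> 0"
      using der[of t] neg[of t] at_within_atLeast_eq[of R t] by auto
  next
    have "continuous_on {R..} v" by (rule DERIV_continuous_on[OF der]) simp
    then show "continuous_on {R..x} v" by (rule continuous_on_subset) auto
  qed
  then have "(\<theta> x - \<eta> x)\<^sup>2 \<le> 0" using eq by (simp add: v_def mult_le_0_iff)
  then show ?thesis by simp
qed

text \<open>
  Solutions are only known to take values in the open interval \<open>W\<close>; a compact interval containing the
  orbit and the rest state is needed to have a slope profile along the whole orbit.
\<close>

lemma convergent_range_bounds: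
  fixes \<theta> :: "real \<Rightarrow> real"
  assumes W: "open W" "is_interval W" "b \<in> W"
    and \<theta>: "continuous_on {R..} \<theta>" "\<And>x. x \<ge> R \<Longrightarrow> \<theta> x \<in> W" "(\<theta> \<longlongrightarrow> b) at_top"
  obtains \<alpha> \<beta> where "\<alpha> \<in> W" "\<beta> \<in> W" "\<alpha> \<le> b" "b \<le> \<beta>" "\<And>x. x \<ge> R \<Longrightarrow> \<alpha> \<le> \<theta> x \<and> \<theta> x \<le> \<beta>"
proof -
  obtain \<epsilon> where \<epsilon>: "0 < \<epsilon>" "cball b \<epsilon> \<subseteq> W" using W open_contains_cball by blast
  have bW: "b - \<epsilon> \<in> W" "b + \<epsilon> \<in> W" using \<epsilon> by (auto simp: subset_iff dist_real_def)
  have "\<forall>\<^sub>F x in at_top. dist (\<theta> x) b < \<epsilon>" using \<theta>(3) \<epsilon>(1) by (auto simp: tendsto_iff)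
  then obtain X where X: "\<And>x. x \<ge> X \<Longrightarrow> \<bar>\<theta> x - b\<bar> < \<epsilon>"
    by (auto simp: eventually_at_top_linorder dist_real_def)
  have cont: "continuous_on {R..max R X} \<theta>" using \<theta>(1) by (rule continuous_on_subset) auto
  have ne: "{R..max R X} \<noteq> {}" by simp
  obtain s t where s: "s \<in> {R..max R X}" "\<And>x. x \<in> {R..max R X} \<Longrightarrow> \<theta> s \<le> \<theta> x"
    and t: "t \<in> {R..max R X}" "\<And>x. x \<in> {R..max R X} \<Longrightarrow> \<theta> x \<le> \<theta> t"
    using continuous_attains_inf[OF compact_Icc ne cont] continuous_attains_sup[OF compact_Icc ne cont] by blast
  show thesis
  proof (rule that[of "min (b - \<epsilon>) (\<theta> s)" "max (b + \<epsilon>) (\<theta> t)"])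
    show "min (b - \<epsilon>) (\<theta> s) \<in> W" using bW \<theta>(2) s(1) by (auto simp: min_def)
    show "max (b + \<epsilon>) (\<theta> t) \<in> W" using bW \<theta>(2) t(1) by (auto simp: max_def)
    fix x assume "R \<le> x"
    then show "min (b - \<epsilon>) (\<theta> s) \<le> \<theta> x \<and> \<theta> x \<le> max (b + \<epsilon>) (\<theta> t)"
      using X[of x] s(2)[of x] t(2)[of x] by (cases "x \<le> max R X") (auto simp: min_def max_def abs_if split: if_splits)
  qed (use \<epsilon> in auto)
qed

text \<open>
  Separation of variables in \<open>y' = - y * r y\<close>. With \<open>y = h * exp (- s)\<close> the equation becomes
  \<open>s' = r y\<close>, so the time as a function of \<open>s\<close> has derivative \<open>1 / r\<close>, bounded below. Freezing the
  integrand for \<open>s < 0\<close> makes this function expanding on the whole line.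
\<close>

lemma stable_orbit_exists:
  assumes h: "0 < h" and r: "slope f {0..h} c r"
  obtains y where "\<And>x. x \<ge> R \<Longrightarrow> y x \<in> {0<..h}"
    and "\<And>x. x \<ge> R \<Longrightarrow> (y has_real_derivative - (y x * r (y x))) (at x)"
    and "y R = h" and "(y \<longlongrightarrow> 0) at_top"
proof -
  have r_cont: "continuous_on {0..h} r" and r_pos: "\<And>y. y \<in> {0..h} \<Longrightarrow> 0 < r y"
    using r by (auto simp: slope_def)
  obtain t where t: "t \<in> {0..h}" "\<And>y. y \<in> {0..h} \<Longrightarrow> r y \<le> r t"
    using continuous_attains_sup[OF compact_Icc _ r_cont] h by auto
  define E where "E s = h * exp (- max 0 s)" for s
  define X' where "X' s = 1 / r (E s)" for s
  have E: "E s \<in> {0..h}" for s using h by (simp add: E_def mult_left_le)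
  have E_cont: "continuous_on UNIV E" unfolding E_def by (intro continuous_intros)
  have "continuous_on UNIV X'"
    unfolding X'_def
    by (intro continuous_on_divide continuous_on_const continuous_on_compose2[OF r_cont E_cont])
      (use E r_pos less_imp_neq[OF r_pos[OF E]] in auto)
  then have "isCont X' s" for s by (simp add: continuous_on_eq_continuous_at)
  then obtain X0 where X0: "\<And>s. (X0 has_real_derivative X' s) (at s)"
    using einterval_antiderivative[of "-\<infinity>" "\<infinity>" X']
    by (auto simp: has_real_derivative_iff_has_vector_derivative)
  define X where "X s = X0 s - X0 0" for s
  have X: "(X has_real_derivative X' s) (at s)" for s
    unfolding X_def using X0 by (auto intro!: derivative_eq_intros)
  have \<mu>: "0 < 1 / r t" "1 / r t \<le> X' s" for s
    using r_pos[OF t(1)] r_pos[OF E] t(2)[OF E] by (auto simp: X'_def intro: divide_left_mono)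
  note S = inverse_of_expanding_map[OF X \<mu>]
  define S where "S = inv X"
  have XS: "X (S u) = u" for u using S(2) by (simp add: S_def bij_is_surj surj_f_inv_f)
  have S0: "S 0 = 0" using XS[of 0] strict_mono_eq[OF S(1), of "S 0" 0] by (simp add: X_def)
  have S_le: "u \<le> S x \<longleftrightarrow> X u \<le> x" for u x
    using strict_mono_less_eq[OF S(1), of u "S x"] XS by simp
  have S_nonneg: "0 \<le> S u" if "0 \<le> u" for u using that S_le[of 0 u] by (simp add: X_def)
  define y where "y x = h * exp (- S (x - R))" for x
  have yE: "y x = E (S (x - R))" if "x \<ge> R" for x
    using S_nonneg[of "x - R"] that by (simp add: y_def E_def)
  show thesis
  proof
    show "y x \<in> {0<..h}" if "x \<ge> R" for x
      using E[of "S (x - R)"] yE[OF that] mult_pos_pos[OF h exp_gt_zero[of "- S (x - R)"]] by (simp add: y_def)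
    show "(y has_real_derivative - (y x * r (y x))) (at x)" if "x \<ge> R" for x
    proof -
      have "(S has_real_derivative r (E (S (x - R)))) (at (x - R))"
        using S(3)[of "x - R"] by (simp add: S_def X'_def)
      then have "((\<lambda>x. S (x - R)) has_real_derivative r (E (S (x - R))) * 1) (at x)"
        by (rule DERIV_chain2) (auto intro!: derivative_eq_intros)
      then show ?thesis
        unfolding y_def yE[OF that, unfolded y_def, symmetric]
        by (auto intro!: derivative_eq_intros)
    qed
    show "y R = h" by (simp add: y_def S0)
    have "filterlim S at_top at_top"
      unfolding filterlim_at_top using S_le by (auto simp: eventually_at_top_linorder)
    moreover have "filterlim (\<lambda>x. x - R) at_top at_top"
      unfolding filterlim_at_top
    proof
      fix Z show "\<forall>\<^sub>F x in at_top. Z \<le> x - R"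
        using eventually_ge_at_top[of "Z + R"] by eventually_elim simp
    qed
    ultimately have "filterlim (\<lambda>x. S (x - R)) at_top at_top" by (rule filterlim_compose)
    then have "((\<lambda>x. exp (- S (x - R))) \<longlongrightarrow> 0) at_top"
      by (intro filterlim_compose[OF exp_at_bot] filterlim_compose[OF filterlim_uminus_at_bot_at_top])
    then show "(y \<longlongrightarrow> 0) at_top"
      unfolding y_def using tendsto_mult_right_zero by blast
  qed
qed

section \<open>The free boundary problem\<close>

lemma smooth_on_cong:
  assumes "smooth_on S g" "\<And>x. x \<in> S \<Longrightarrow> f x = g x"
  shows "smooth_on S f"
  using assms unfolding smooth_on_def by auto

locale front =
  fixes q a b :: real and F :: "real \<Rightarrow> real" and W :: "real set"
  assumes q: "q > 0" and a: "0 < a" and ab: "a < b"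
    and W: "open W" "is_interval W" "{a..b} \<subseteq> W"
    and F_smooth: "smooth_on W F"
    and F_pos: "\<And>u. u \<in> {a..<b} \<Longrightarrow> 0 < F u"
    and F'_neg: "deriv F b < 0"
    and F_zero: "\<And>u. u \<in> W \<Longrightarrow> F u = 0 \<longleftrightarrow> u = b"
begin

text \<open>
  The continuous extension of \<open>F (b - y) / y\<close>, positive on both sides of the rest state.
\<close>

definition f where "f y = (if y = 0 then - deriv F b else F (b - y) / y)"

lemma W_between: "u \<in> W \<Longrightarrow> v \<in> W \<Longrightarrow> {u..v} \<subseteq> W"
  using W(2) unfolding is_interval_1 by (meson atLeastAtMost_iff subsetI)

lemma F_derivative: "(F has_real_derivative deriv F u) (at u)" if u: "u \<in> W"
proof -
  obtain D where D: "\<forall>x\<in>W. D 0 x = F x"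
    "\<And>k x. x \<in> W \<Longrightarrow> (D k has_real_derivative D (Suc k) x) (at x within W)"
    using F_smooth unfolding smooth_on_def by blast
  have "(D 0 has_real_derivative D (Suc 0) u) (at u)"
    using D(2)[OF u, of 0] at_within_open[OF u W(1)] by simp
  then have "(F has_real_derivative D (Suc 0) u) (at u)"
    by (rule has_field_derivative_transform_within_open[OF _ W(1) u]) (use D(1) in simp)
  then show ?thesis by (simp add: DERIV_imp_deriv)
qed

lemma F_continuous: "S \<subseteq> W \<Longrightarrow> continuous_on S F"
  by (rule DERIV_continuous_on[of _ _ "deriv F"])
    (auto intro: has_field_derivative_at_within F_derivative)

lemma b_W: "b \<in> W" and F_b: "F b = 0"
proof -
  show "b \<in> W" using W(3) ab by auto
  then show "F b = 0" using F_zero[of b] by simp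
qed

text \<open>
  \<open>F\<close> keeps its sign on either side of its only zero; on the right the sign is that of \<open>F' b\<close>.
\<close>

lemma F_left: "0 < F u" if u: "u \<in> W" "u < b"
proof (cases "a \<le> u")
  case True
  then show ?thesis using F_pos u by simp
next
  case False
  show ?thesis
  proof (rule ccontr)
    assume "\<not> 0 < F u"
    then have 1: "F u \<le> 0" by simp
    have 2: "0 \<le> F a" "u \<le> a" using F_pos[of a] ab False by auto
    have sub: "{u..a} \<subseteq> W" by (rule W_between[OF u(1)]) (use W(3) ab in auto)
    obtain v where "u \<le> v" "v \<le> a" "F v = 0"
      using IVT'[OF 1 2 F_continuous[OF sub]] by blast
    moreover from this have "v \<in> W" using sub by (auto simp: subset_iff)
    ultimately show False using F_zero[of v] ab by linarith
  qed
qed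

lemma F_right: "F u < 0" if u: "u \<in> W" "b < u"
proof (rule ccontr)
  assume neg: "\<not> F u < 0"
  obtain d where d: "0 < d" "\<And>t. 0 < t \<Longrightarrow> t < d \<Longrightarrow> F (b + t) < F b"
    using DERIV_neg_dec_right[OF F_derivative[OF b_W] F'_neg] by blast
  define t where "t = min (d / 2) (u - b)"
  have t: "0 < t" "t < d" "b + t \<le> u" using d(1) u(2) by (auto simp: t_def min_def)
  have sub: "{b + t..u} \<subseteq> W" using W_between[OF b_W u(1)] t(1) by auto
  have 1: "F (b + t) \<le> 0" "0 \<le> F u" using d(2)[OF t(1,2)] F_b neg by auto
  obtain v where "b + t \<le> v" "v \<le> u" "F v = 0"
    using IVT'[OF 1 t(3) F_continuous[OF sub]] by blast
  moreover from this have "v \<in> W" using sub by (auto simp: subset_iff)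
  ultimately show False using F_zero[of v] t(1) by linarith
qed

lemma F_eq: "F (b - y) = y * f y"
  by (simp add: f_def F_b)

lemma quotient_pos: "0 < f y" if "b - y \<in> W"
proof (cases y "0 :: real" rule: linorder_cases)
  case less
  then show ?thesis using F_right[OF that] by (simp add: f_def divide_neg_neg)
next
  case equal
  then show ?thesis using F'_neg by (simp add: f_def)
next
  case greater
  then show ?thesis using F_left[OF that] by (simp add: f_def)
qed

lemma quotient_continuous:
  assumes "\<And>y. y \<in> J \<Longrightarrow> b - y \<in> W"
  shows "continuous_on J f"
proof -
  have der: "((\<lambda>y. F (b - y)) has_real_derivative deriv F (b - y) * - 1) (at y)" if "b - y \<in> W" for y
  proof -
    have "((-) b has_real_derivative - 1) (at y)"
      using DERIV_diff[OF DERIV_const[of b] DERIV_ident, of y UNIV] by simp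
    from DERIV_chain2[where f = F and g = "\<lambda>y. b - y", OF F_derivative[OF that] this] show ?thesis .
  qed
  have "isCont f y" if y: "b - y \<in> W" for y
  proof (cases "y = 0")
    case False
    have "isCont (\<lambda>y. F (b - y) / y) y"
      using False by (intro isCont_divide DERIV_isCont[OF der[OF y]] continuous_ident) auto
    moreover have "\<forall>\<^sub>F t in nhds y. F (b - t) / t = f t"
      using False by (intro eventually_mono[OF t1_space_nhds[of y 0]]) (auto simp: f_def)
    ultimately show ?thesis by (simp add: isCont_cong)
  next
    case True
    have "((\<lambda>y. F (b - y)) has_real_derivative - deriv F b) (at 0)"
      using der[of 0] b_W by simp
    then have "((\<lambda>y. F (b - y) / y) \<longlongrightarrow> - deriv F b) (at 0)"
      by (simp add: has_field_derivative_iff F_b)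
    then have "(f \<longlongrightarrow> - deriv F b) (at 0)"
      by (rule Lim_transform_eventually) (auto simp: eventually_at_filter f_def)
    then show ?thesis by (simp add: True isCont_def f_def)
  qed
  then show ?thesis using assms by (intro continuous_at_imp_continuous_on) blast
qed

definition "d = b - a"

lemma d_pos: "0 < d" using ab by (simp add: d_def)

lemma d_W: "y \<in> {0..d} \<Longrightarrow> b - y \<in> W"
  using W(3) by (auto simp: d_def subset_iff)

sublocale slope_problem f d
  by standard (use d_pos quotient_pos quotient_continuous d_W in blast)+

abbreviation "P \<equiv> exit_slope f d"
definition "G c = (a * c - P c) / q"

lemma solution_slope:
  assumes sol: "is_solution F W q a b R c \<theta>"
    and J: "l \<le> 0" "d \<le> h" "b - h \<in> W" "b - l \<in> W" "\<And>x. x \<ge> R \<Longrightarrow> b - \<theta> x \<in> {l..h}"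
    and r: "slope f {l..h} c r"
  shows "\<And>x. x \<ge> R \<Longrightarrow> (\<theta> has_real_derivative (b - \<theta> x) * r (b - \<theta> x)) (at x within {R..})"
    and "\<theta> R = a" and "P c = c * a - q * R"
proof -
  obtain \<theta>1 \<theta>2 where s:
    "\<And>x. x \<ge> R \<Longrightarrow> (\<theta> has_real_derivative \<theta>1 x) (at x within {R..})"
    "continuous_on {R..} \<theta>1"
    "\<And>x. x > R \<Longrightarrow> (\<theta>1 has_real_derivative \<theta>2 x) (at x)"
    "\<And>x. x > R \<Longrightarrow> \<theta>2 x - c * \<theta>1 x + F (\<theta> x) = 0"
    "\<theta> R = a" "\<theta>1 R = c * a - q * R" "(\<theta> \<longlongrightarrow> b) at_top"
    using sol unfolding is_solution_def by blast
  have JW: "b - y \<in> W" if "y \<in> {l..h}" for y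
    using W_between[OF J(3,4)] that by (auto simp: subset_iff)
  have zero: "0 \<in> {l..h}" using J d_pos by simp
  have eq: "\<theta>1 x = (b - \<theta> x) * r (b - \<theta> x)" if "x \<ge> R" for x
    by (rule solution_on_stable_curve[where F = F and f = f and b = b and J = "{l..h}",
          OF s(1-4) s(7) r J(5) zero _ F_eq that]) (use quotient_pos JW in blast)+
  show "(\<theta> has_real_derivative (b - \<theta> x) * r (b - \<theta> x)) (at x within {R..})" if "x \<ge> R" for x
    using s(1)[OF that] eq[OF that] by simp
  show "\<theta> R = a" by (rule s(5))
  have "P c = d * r d" by (rule exit_slope_eq[OF r]) (use J in auto)
  then show "P c = c * a - q * R" using eq[of R] s(5,6) by (simp add: d_def)
qed

lemma solution_range:
  assumes "is_solution F W q a b R c \<theta>"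
  obtains \<alpha> \<beta> where "\<alpha> \<in> W" "\<beta> \<in> W" "\<alpha> \<le> a" "b \<le> \<beta>" "\<And>x. x \<ge> R \<Longrightarrow> \<alpha> \<le> \<theta> x \<and> \<theta> x \<le> \<beta>"
proof -
  obtain \<theta>1 where "\<And>x. x \<ge> R \<Longrightarrow> (\<theta> has_real_derivative \<theta>1 x) (at x within {R..})"
    and R: "\<theta> R = a" and lim: "(\<theta> \<longlongrightarrow> b) at_top" and inW: "\<And>x. x \<ge> R \<Longrightarrow> \<theta> x \<in> W"
    using assms unfolding is_solution_def by blast
  then have "continuous_on {R..} \<theta>" by (intro DERIV_continuous_on[of _ _ \<theta>1]) simp
  from convergent_range_bounds[OF W(1,2) b_W this inW lim]
  obtain \<alpha> \<beta> where "\<alpha> \<in> W" "\<beta> \<in> W" "b \<le> \<beta>" "\<And>x. x \<ge> R \<Longrightarrow> \<alpha> \<le> \<theta> x \<and> \<theta> x \<le> \<beta>" by blast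
  then show thesis using that[of \<alpha> \<beta>] R by force
qed

lemma slope_exists:
  assumes "l \<le> 0" "0 \<le> h" "b - h \<in> W" "b - l \<in> W"
  obtains r where "slope f {l..h} c r"
proof -
  have JW: "b - y \<in> W" if "y \<in> {l..h}" for y
    using W_between[OF assms(3,4)] that by (auto simp: subset_iff)
  have C: "0 < \<bar>c\<bar> + 1" by simp
  have "0 < f y" if "y \<in> {l..h}" for y using quotient_pos JW that by blast
  from slope_family[OF assms(1,2) quotient_continuous[OF JW] this C]
  obtain r where "\<And>b. \<bar>b\<bar> < \<bar>c\<bar> + 1 \<Longrightarrow> slope f {l..h} b (\<lambda>y. Re (r y (complex_of_real b)))"
    by blast
  then have "slope f {l..h} c (\<lambda>y. Re (r y (complex_of_real c)))" by simp
  then show thesis by (rule that)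
qed

lemma solution_exit_slope:
  assumes sol: "is_solution F W q a b R c \<theta>"
  shows "P c = c * a - q * R"
proof -
  obtain \<alpha> \<beta> where \<alpha>\<beta>: "\<alpha> \<in> W" "\<beta> \<in> W" "\<alpha> \<le> a" "b \<le> \<beta>" "\<And>x. x \<ge> R \<Longrightarrow> \<alpha> \<le> \<theta> x \<and> \<theta> x \<le> \<beta>"
    using solution_range[OF sol] by blast
  obtain r where r: "slope f {b - \<beta>..b - \<alpha>} c r"
    using slope_exists[of "b - \<beta>" "b - \<alpha>" c] \<alpha>\<beta> ab by auto
  show ?thesis
    by (rule solution_slope(3)[OF sol _ _ _ _ _ r]) (use \<alpha>\<beta> in \<open>auto simp: d_def\<close>)
qed

text \<open>
  Two solutions share a compact range, hence a slope profile, and both solve the same autonomous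
  first-order equation.
\<close>

lemma solution_unique:
  assumes \<theta>: "is_solution F W q a b R c \<theta>" and \<eta>: "is_solution F W q a b R c \<eta>" and x: "x \<ge> R"
  shows "\<theta> x = \<eta> x"
proof -
  obtain \<alpha>1 \<beta>1 where 1: "\<alpha>1 \<in> W" "\<beta>1 \<in> W" "\<alpha>1 \<le> a" "b \<le> \<beta>1" "\<And>x. x \<ge> R \<Longrightarrow> \<alpha>1 \<le> \<theta> x \<and> \<theta> x \<le> \<beta>1"
    using solution_range[OF \<theta>] by blast
  obtain \<alpha>2 \<beta>2 where 2: "\<alpha>2 \<in> W" "\<beta>2 \<in> W" "\<alpha>2 \<le> a" "b \<le> \<beta>2" "\<And>x. x \<ge> R \<Longrightarrow> \<alpha>2 \<le> \<eta> x \<and> \<eta> x \<le> \<beta>2"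
    using solution_range[OF \<eta>] by blast
  define l h where "l = b - max \<beta>1 \<beta>2" and "h = b - min \<alpha>1 \<alpha>2"
  have lh: "l \<le> 0" "d \<le> h" "b - h \<in> W" "b - l \<in> W"
    using 1 2 by (auto simp: l_def h_def d_def min_def max_def)
  have \<theta>J: "b - \<theta> x \<in> {l..h}" if "x \<ge> R" for x using 1(5)[OF that] by (auto simp: l_def h_def)
  have \<eta>J: "b - \<eta> x \<in> {l..h}" if "x \<ge> R" for x using 2(5)[OF that] by (auto simp: l_def h_def)
  obtain r where r: "slope f {l..h} c r" using slope_exists[of l h c] lh d_pos by auto
  have "continuous_on {l..h} f"
    by (rule quotient_continuous) (use W_between[OF lh(3,4)] in \<open>auto simp: subset_iff\<close>)
  from slope_lipschitz[OF r this] obtain L where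
    "\<forall>y\<in>{l..h}. \<forall>y'\<in>{l..h}. \<bar>y * r y - y' * r y'\<bar> \<le> L * \<bar>y - y'\<bar>" ..
  then have L: "\<bar>y * r y - y' * r y'\<bar> \<le> L * \<bar>y - y'\<bar>" if "y \<in> {l..h}" "y' \<in> {l..h}" for y y'
    using that by blast
  show ?thesis
  proof (rule autonomous_unique[where P = "\<lambda>u. (b - u) * r (b - u)" and L = L, OF _ _ _ _ x])
    show "(\<theta> has_real_derivative (b - \<theta> x) * r (b - \<theta> x)) (at x within {R..})" if "x \<ge> R" for x
      by (rule solution_slope(1)[OF \<theta> lh \<theta>J r that])
    show "(\<eta> has_real_derivative (b - \<eta> x) * r (b - \<eta> x)) (at x within {R..})" if "x \<ge> R" for x
      by (rule solution_slope(1)[OF \<eta> lh \<eta>J r that])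
    show "\<theta> R = \<eta> R"
      using solution_slope(2)[OF \<theta> lh \<theta>J r] solution_slope(2)[OF \<eta> lh \<eta>J r] by simp
    show "\<bar>(b - \<theta> x) * r (b - \<theta> x) - (b - \<eta> x) * r (b - \<eta> x)\<bar> \<le> L * \<bar>\<theta> x - \<eta> x\<bar>" if "x \<ge> R" for x
      using L[OF \<theta>J[OF that] \<eta>J[OF that]] by (simp add: abs_minus_commute)
  qed
qed

lemma solution_exists:
  assumes c: "P c = c * a - q * R"
  shows "\<exists>\<theta>. is_solution F W q a b R c \<theta>"
proof -
  obtain r where r: "slope f {0..d} c r" "P c = d * r d" by (rule exit_slope_obtain)
  obtain y where y: "\<And>x. x \<ge> R \<Longrightarrow> y x \<in> {0<..d}"
    "\<And>x. x \<ge> R \<Longrightarrow> (y has_real_derivative - (y x * r (y x))) (at x)"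
    "y R = d" "(y \<longlongrightarrow> 0) at_top"
    using stable_orbit_exists[OF d_pos r(1)] by blast
  define \<theta> \<theta>1 where "\<theta> x = b - y x" and "\<theta>1 x = y x * r (y x)" for x
  have yd: "y x \<in> {0..d}" if "x \<ge> R" for x using y(1)[OF that] by auto
  have y_cont: "continuous_on {R..} y"
    by (rule DERIV_continuous_on[OF has_field_derivative_at_within[OF y(2)]]) simp
  have "is_solution F W q a b R c \<theta>"
    unfolding is_solution_def
  proof (intro conjI allI impI, goal_cases)
    case (1 x)
    then show ?case using d_W[OF yd] by (simp add: \<theta>_def)
  next
    case 2
    show ?case
    proof (rule exI[of _ \<theta>1], rule exI[of _ "\<lambda>x. c * \<theta>1 x - F (\<theta> x)"], intro conjI allI impI)
    show "(\<theta> has_real_derivative \<theta>1 x) (at x within {R..})" if "R \<le> x" for x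
      unfolding \<theta>_def \<theta>1_def
      by (rule derivative_eq_intros refl has_field_derivative_at_within[OF y(2)[OF that]])+ simp
    show "continuous_on {R..} \<theta>1"
      unfolding \<theta>1_def using yd
      by (intro continuous_on_compose2[OF slope_continuous[OF r(1)] y_cont]) auto
    show "(\<theta>1 has_real_derivative c * \<theta>1 x - F (\<theta> x)) (at x)" if x: "R < x" for x
    proof -
      have yx: "y x \<in> {0..d}" using yd x by simp
      have r': "0 < r (y x)" "((\<lambda>y. y * r y) has_real_derivative f (y x) / r (y x) - c) (at (y x) within {0..d})"
        using r(1) yx by (auto simp: slope_def)
      have "((\<lambda>x. y x * r (y x)) has_real_derivative (f (y x) / r (y x) - c) * - (y x * r (y x))) (at x within {R..})"
        by (rule DERIV_chain_subset[where f = "\<lambda>y. y * r y" and g = y, OF r'(2)])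
          (use yd x in \<open>auto intro!: has_field_derivative_at_within[OF y(2)]\<close>)
      moreover have "(f (y x) / r (y x) - c) * - (y x * r (y x)) = c * \<theta>1 x - F (\<theta> x)"
        using r'(1) by (simp add: \<theta>1_def \<theta>_def F_eq field_simps)
      ultimately show ?thesis
        using at_within_atLeast_eq[OF x] by (simp add: \<theta>1_def[abs_def])
    qed
    show "\<theta> R = a" by (simp add: \<theta>_def y(3) d_def)
    show "\<theta>1 R = c * a - q * R" using c r(2) by (simp add: \<theta>1_def y(3))
    qed simp
  next
    case 3
    show ?case
      unfolding \<theta>_def using tendsto_diff[OF tendsto_const[of b] y(4)] by simp
  qed
  then show ?thesis by blast
qed

lemma P_below_energy: "P c < sqrt (2 * integral {a..b} F)" if c: "0 < c"
proof -
  obtain r where r: "slope f {0..d} c r" "P c = d * r d" by (rule exit_slope_obtain)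
  have "continuous_on {a..b} F" using F_continuous W(3) by blast
  then obtain A where A: "\<And>u. u \<in> {a..b} \<Longrightarrow> (A has_real_derivative F u) (at u within {a..b})"
    using antiderivative_continuous[of a b F]
    unfolding has_real_derivative_iff_has_vector_derivative by blast
  have "(F has_integral A b - A a) {a..b}"
    using A ab by (intro fundamental_theorem_of_calculus)
      (auto simp: has_real_derivative_iff_has_vector_derivative)
  then have I: "integral {a..b} F = A b - A a" by (rule integral_unique)
  have "((\<lambda>y. - A (b - y)) has_real_derivative y * f y) (at y within {0..d})" if y: "y \<in> {0..d}" for y
  proof -
    have yd: "((\<lambda>y. b - y) has_real_derivative - 1) (at y within {0..d})"
      by (auto intro!: derivative_eq_intros)
    have bu: "b - y \<in> {a..b}" using y by (auto simp: d_def)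
    have "((\<lambda>y. A (b - y)) has_real_derivative F (b - y) * - 1) (at y within {0..d})"
      by (rule DERIV_chain_subset[where f = A and g = "\<lambda>y. b - y", OF A[OF bu] _ yd]) (auto simp: d_def)
    from DERIV_minus[OF this] show ?thesis by (simp add: F_eq)
  qed
  moreover have "b - d = a" by (simp add: d_def)
  ultimately have "(P c)\<^sup>2 < 2 * integral {a..b} F"
    using slope_energy[OF r(1) c d_pos, of "\<lambda>y. - A (b - y)"] by (simp add: r(2) I)
  then show ?thesis by (rule real_less_rsqrt)
qed

lemma G_analytic: "real_analytic G"
  unfolding real_analytic_def
proof
  fix c0
  obtain U P' where U: "open U" "complex_of_real c0 \<in> U" "P' holomorphic_on U"
    "\<And>c. complex_of_real c \<in> U \<Longrightarrow> P' (complex_of_real c) = complex_of_real (P c)"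
    using exit_slope_analytic[of c0] by blast
  have "(\<lambda>c. (of_real a * c - P' c) / of_real q) holomorphic_on U"
    using q by (intro holomorphic_intros U(3)) simp
  then show "\<exists>U H. open U \<and> complex_of_real c0 \<in> U \<and> H holomorphic_on U \<and>
      (\<forall>c. complex_of_real c \<in> U \<longrightarrow> H (complex_of_real c) = complex_of_real (G c))"
    using U by (intro exI[of _ U] exI[of _ "\<lambda>c. (of_real a * c - P' c) / of_real q"])
      (simp add: G_def)
qed

text \<open>
  The contribution of \<open>- P\<close> to the derivative is nonnegative because \<open>P\<close> is decreasing.
\<close>

lemma G_derivative: "(G has_real_derivative deriv G c) (at c)" "a / q \<le> deriv G c"
proof -
  show der: "(G has_real_derivative deriv G c) (at c)"
    by (rule real_analytic_has_derivative[OF G_analytic])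
  show "a / q \<le> deriv G c"
  proof (rule ccontr)
    assume "\<not> ?thesis"
    then have "deriv G c - a / q < 0" by simp
    moreover have "((\<lambda>c. G c - a / q * c) has_real_derivative deriv G c - a / q) (at c)"
      by (intro DERIV_diff der DERIV_cmult_Id)
    ultimately obtain e where e: "0 < e" "\<And>t. 0 < t \<Longrightarrow> t < e \<Longrightarrow> G (c + t) - a / q * (c + t) < G c - a / q * c"
      using DERIV_neg_dec_right by blast
    have "G (c + e / 2) - a / q * (c + e / 2) < G c - a / q * c" using e by simp
    moreover have "G t - a / q * t = - P t / q" for t by (simp add: G_def diff_divide_distrib)
    ultimately have "P c < P (c + e / 2)" using q by (simp add: divide_less_cancel)
    then show False using exit_slope_antimono[of c "c + e / 2"] e(1) by simp
  qed
qed

theorem free_boundary_curve: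
  "\<exists>\<psi> :: real \<Rightarrow> real.
      (diffeomorphism_betw \<psi> {0..} {\<psi> 0..} \<and> \<psi> 0 > 0 \<and>
       (\<forall>R\<ge>0. \<forall>c>0. (\<exists>\<theta>. is_solution F W q a b R c \<theta>) \<longleftrightarrow> c = \<psi> R) \<and>
       (\<forall>R\<ge>0. \<forall>c>0. \<forall>\<theta> \<eta>.
          is_solution F W q a b R c \<theta> \<longrightarrow> is_solution F W q a b R c \<eta> \<longrightarrow>
          (\<forall>x\<ge>R. \<theta> x = \<eta> x))) \<and>
      (strict_mono_on {0..} \<psi> \<and> filterlim \<psi> at_top at_top \<and>
       ((\<lambda>R. \<psi> R - q * R / a) \<longlongrightarrow> 0) at_top) \<and>
      ((\<forall>R>0. (R, \<psi> R) \<in> Q_plus q a) \<and>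
       (\<forall>R\<ge>0. q * R / a < \<psi> R \<and> \<psi> R < c_plus F q a b R))"
proof -
  have \<mu>: "0 < a / q" using a q by simp
  note G = inverse_of_expanding_map[OF G_derivative(1) \<mu> G_derivative(2)]
  define \<psi> where "\<psi> = inv G"
  have G\<psi>: "G (\<psi> R) = R" for R using G(2) by (simp add: \<psi>_def bij_is_surj surj_f_inv_f)
  have \<psi>_iff: "c = \<psi> R \<longleftrightarrow> G c = R" for c R using G\<psi> strict_mono_eq[OF G(1)] by metis
  have le_iff: "u \<le> \<psi> R \<longleftrightarrow> G u \<le> R" for u R
    using strict_mono_less_eq[OF G(1), of u "\<psi> R"] G\<psi> by simp
  have G_eq: "G c = R \<longleftrightarrow> P c = c * a - q * R" for c R
    using q by (auto simp: G_def field_simps)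
  have P\<psi>: "P (\<psi> R) = \<psi> R * a - q * R" for R using G_eq G\<psi> by blast
  have mono: "\<psi> R < \<psi> R'" if "R < R'" for R R'
    using strict_mono_less[OF G(1), of "\<psi> R" "\<psi> R'"] G\<psi> that by simp
  have "G 0 < 0" using exit_slope_pos[of 0] q by (simp add: G_def)
  then have \<psi>0: "0 < \<psi> 0" using strict_mono_less[OF G(1), of 0 "\<psi> 0"] G\<psi> by simp
  have \<psi>_pos: "0 < \<psi> R" if "0 \<le> R" for R using mono[of 0 R] \<psi>0 that by (cases "R = 0") auto
  \<comment> \<open>\<open>\<psi>\<close> inverts \<open>G\<close> on the whole line; on the half-lines it remains to identify the image.\<close>
  have img: "\<psi> ` {0..} = {\<psi> 0..}"
  proof (intro set_eqI iffI)
    fix c assume "c \<in> \<psi> ` {0..}"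
    then show "c \<in> {\<psi> 0..}" using mono[of 0] by (force simp: less_eq_real_def)
  next
    fix c assume "c \<in> {\<psi> 0..}"
    then have "0 \<le> G c" using strict_mono_less_eq[OF G(1), of "\<psi> 0" c] G\<psi> by simp
    then show "c \<in> \<psi> ` {0..}" using \<psi>_iff[of c "G c"] by auto
  qed
  have inj: "inj_on \<psi> {0..}" using G\<psi> by (metis inj_on_inverseI)
  have inv: "inv_into {0..} \<psi> c = G c" if "c \<in> {\<psi> 0..}" for c
  proof -
    have "\<psi> (inv_into {0..} \<psi> c) = c" using that img by (intro f_inv_into_f) auto
    then show ?thesis using G\<psi> by metis
  qed
  have "deriv G c \<noteq> 0" for c using G_derivative(2)[of c] \<mu> by linarith
  from real_analytic_inverse_smooth_on[OF G_analytic this G(3)]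
  have "smooth_on {0..} \<psi>" by (simp add: \<psi>_def)
  moreover have "smooth_on {\<psi> 0..} (inv_into {0..} \<psi>)"
    by (rule smooth_on_cong[OF real_analytic_imp_smooth_on[OF G_analytic] inv])
  ultimately have diffeo: "diffeomorphism_betw \<psi> {0..} {\<psi> 0..}"
    using inj img by (simp add: diffeomorphism_betw_def bij_betw_def)
  have iff: "(\<exists>\<theta>. is_solution F W q a b R c \<theta>) \<longleftrightarrow> c = \<psi> R" for R c
    unfolding \<psi>_iff G_eq using solution_exists solution_exit_slope by blast
  have top: "filterlim \<psi> at_top at_top"
    unfolding filterlim_at_top using le_iff by (auto simp: eventually_at_top_linorder)
  have diff: "\<psi> R - q * R / a = P (\<psi> R) / a" for R
    using P\<psi>[of R] a by (simp add: field_simps)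
  have "((\<lambda>R. P (\<psi> R) / a) \<longlongrightarrow> 0 / a) at_top"
    using a by (intro tendsto_intros filterlim_compose[OF exit_slope_tendsto_0 top]) auto
  then have asym: "((\<lambda>R. \<psi> R - q * R / a) \<longlongrightarrow> 0) at_top" by (simp add: diff)
  have lower: "q * R / a < \<psi> R" for R
    using diff[of R] divide_pos_pos[OF exit_slope_pos a] by (metis diff_gt_0_iff_gt)
  have upper: "\<psi> R < c_plus F q a b R" if "0 \<le> R" for R
  proof -
    have "\<psi> R * a < sqrt (2 * integral {a..b} F) + q * R"
      using P_below_energy[OF \<psi>_pos[OF that]] P\<psi>[of R] by simp
    then show ?thesis using a by (simp add: c_plus_def field_simps)
  qed
  show ?thesis
    using diffeo \<psi>0 iff solution_unique mono top asym lower upper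
    by (intro exI[of _ \<psi>] conjI allI impI)
      (auto simp: strict_mono_on_def Q_plus_def intro: less_imp_le)
qed

end

theorem theorem2p3:
  fixes q \<theta>hl \<theta>p :: real and F :: "real \<Rightarrow> real" and W :: "real set"
  assumes "q > 0"
    and "0 < \<theta>hl" and "\<theta>hl < \<theta>p"
    and "open W" and "is_interval W" and "{\<theta>hl..\<theta>p} \<subseteq> W"
    and "smooth_on W F"
    and "\<forall>u\<in>{\<theta>hl..<\<theta>p}. F u > 0"
    and "deriv F \<theta>p < 0"
    and "\<forall>u\<in>W. F u = 0 \<longleftrightarrow> u = \<theta>p"
  shows "\<exists>\<psi> :: real \<Rightarrow> real.
      (diffeomorphism_betw \<psi> {0..} {\<psi> 0..} \<and> \<psi> 0 > 0 \<and>
       (\<forall>R\<ge>0. \<forall>c>0. (\<exists>\<theta>. is_solution F W q \<theta>hl \<theta>p R c \<theta>) \<longleftrightarrow> c = \<psi> R) \<and>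
       (\<forall>R\<ge>0. \<forall>c>0. \<forall>\<theta> \<eta>.
          is_solution F W q \<theta>hl \<theta>p R c \<theta> \<longrightarrow> is_solution F W q \<theta>hl \<theta>p R c \<eta> \<longrightarrow>
          (\<forall>x\<ge>R. \<theta> x = \<eta> x))) \<and>
      (strict_mono_on {0..} \<psi> \<and> filterlim \<psi> at_top at_top \<and>
       ((\<lambda>R. \<psi> R - q * R / \<theta>hl) \<longlongrightarrow> 0) at_top) \<and>
      ((\<forall>R>0. (R, \<psi> R) \<in> Q_plus q \<theta>hl) \<and>
       (\<forall>R\<ge>0. q * R / \<theta>hl < \<psi> R \<and> \<psi> R < c_plus F q \<theta>hl \<theta>p R))"
proof -
  interpret front q \<theta>hl \<theta>p F W
    by unfold_locales (use assms in blast)+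
  show ?thesis by (rule free_boundary_curve)
qed

end
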